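(* Let $(M,g)$ be a radical-stationary singular semi-Riemannian manifold with constant signature, and let $\nabla$ be a Koszul derivative on $M$. Then for all $X,Y,Z,T\in\mathfrak X(M)$, $$g(R_\nabla(X,Y)Z,T)=R(X,Y,Z,T).$$
   Context: $(M,g)$: smooth manifold with smooth symmetric, possibly degenerate, bilinear form $g$ on $TM$, here of constant signature. $u^\flat(v)=g(u,v)$; $T^\bullet_pM=\{u^\flat:u\in T_pM\}$ with nondegenerate inner product $\langle\langle u^\flat,v^\flat\rangle\rangle=g(u,v)$; $\mathcal A^\bullet(M)$ = smooth $1$-forms valued in $T^\bullet_pM$. Koszul form $\mathcal K(X,Y,Z)=\tfrac12\{Xg(Y,Z)+Yg(Z,X)-Zg(X,Y)-g(X,[Y,Z])+g(Y,[Z,X])+g(Z,[X,Y])\}$; $\nabla^\flat_XY:=\mathcal K(X,Y,\cdot)$. Radical-stationary: $\nabla^\flat_XY\in\mathcal A^\bullet(M)$ for all $X,Y$. For $\omega\in\mathcal A^\bullet(M)$, $(\nabla_X\omega)(Y)=X(\omega(Y))-\langle\langle\nabla^\flat_XY,\omega\rangle\rangle$, and $R(X,Y,Z,T)=(\nabla_X(\nabla^\flat_YZ))(T)-(\nabla_Y(\nabla^\flat_XZ))(T)-(\nabla^\flat_{[X,Y]}Z)(T)$. A Koszul derivative is an operator $\nabla:\mathfrak X(M)\times\mathfrak X(M)\to\mathfrak X(M)$ with $g(\nabla_XY,Z)=\mathcal K(X,Y,Z)$ for all $X,Y,Z$; its curvature function is $R_\nabla(X,Y)Z=\nabla_X\nabla_YZ-\nabla_Y\nabla_XZ-\nabla_{[X,Y]}Z$.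 *)

theory Defs
  imports "HOL-Analysis.Analysis" "HOL-Library.Function_Algebras"
begin

instantiation "fun" :: (type, real_vector) real_vector
begin
definition scaleR_fun :: "real \<Rightarrow> ('a \<Rightarrow> 'b) \<Rightarrow> 'a \<Rightarrow> 'b"
  where "scaleR_fun c f = (\<lambda>x. c *\<^sub>R f x)"
instance by standard (auto simp: scaleR_fun_def fun_eq_iff algebra_simps)
end

definition dir_deriv :: "'n::euclidean_space \<Rightarrow> ('n \<Rightarrow> real) \<Rightarrow> 'n \<Rightarrow> real" where
  "dir_deriv b f x = deriv (\<lambda>t. f (x + t *\<^sub>R b)) 0"

fun iter_dd :: "'n::euclidean_space list \<Rightarrow> ('n \<Rightarrow> real) \<Rightarrow> 'n \<Rightarrow> real" where
  "iter_dd [] f = f"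
| "iter_dd (b # bs) f = dir_deriv b (iter_dd bs f)"

definition smooth_on :: "'n::euclidean_space set \<Rightarrow> ('n \<Rightarrow> real) \<Rightarrow> bool" where
  "smooth_on U f \<longleftrightarrow>
     (\<forall>bs. set bs \<subseteq> Basis \<longrightarrow>
        continuous_on U (iter_dd bs f) \<and>
        (\<forall>x\<in>U. \<forall>b\<in>Basis. (\<lambda>t. iter_dd bs f (x + t *\<^sub>R b)) differentiable (at 0)))"

definition smooth_map_on :: "'n::euclidean_space set \<Rightarrow> ('n \<Rightarrow> 'm::euclidean_space) \<Rightarrow> bool" where
  "smooth_map_on U F \<longleftrightarrow> (\<forall>i\<in>Basis. smooth_on U (\<lambda>x. F x \<bullet> i))"

definition smooth_atlas :: "('a::topological_space set \<times> ('a \<Rightarrow> 'n::euclidean_space)) set \<Rightarrow> bool" where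
  "smooth_atlas A \<longleftrightarrow>
     (\<forall>p. \<exists>(U, \<phi>)\<in>A. p \<in> U) \<and>
     (\<forall>(U, \<phi>)\<in>A. open U \<and> open (\<phi> ` U) \<and> inj_on \<phi> U \<and>
         homeomorphism U (\<phi> ` U) \<phi> (inv_into U \<phi>)) \<and>
     (\<forall>(U, \<phi>)\<in>A. \<forall>(V, \<psi>)\<in>A. smooth_map_on (\<phi> ` (U \<inter> V)) (\<psi> \<circ> inv_into U \<phi>))"

definition smooth_manifold ::
  "('a::{t2_space, second_countable_topology} set \<times> ('a \<Rightarrow> 'n::euclidean_space)) set \<Rightarrow> bool" where
  "smooth_manifold A \<longleftrightarrow> smooth_atlas A"

definition smooth_fun :: "('a::topological_space set \<times> ('a \<Rightarrow> 'n::euclidean_space)) set \<Rightarrow> ('a \<Rightarrow> real) \<Rightarrow> bool" where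
  "smooth_fun A f \<longleftrightarrow> (\<forall>(U, \<phi>)\<in>A. smooth_on (\<phi> ` U) (f \<circ> inv_into U \<phi>))"

text \<open>Tangent space at p: derivations at p of the algebra of smooth functions
  (normalised to vanish on non-smooth functions).\<close>
definition tangent_space :: "('a::topological_space set \<times> ('a \<Rightarrow> 'n::euclidean_space)) set \<Rightarrow> 'a \<Rightarrow> (('a \<Rightarrow> real) \<Rightarrow> real) set" where
  "tangent_space A p = {v.
     (\<forall>f. \<not> smooth_fun A f \<longrightarrow> v f = 0) \<and>
     (\<forall>f h. smooth_fun A f \<and> smooth_fun A h \<longrightarrow>
        v (f + h) = v f + v h \<and> v (\<lambda>x. f x * h x) = f p * v h + h p * v f) \<and>
     (\<forall>c f. smooth_fun A f \<longrightarrow> v (c *\<^sub>R f) = c * v f)}"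

definition vector_field :: "('a::topological_space set \<times> ('a \<Rightarrow> 'n::euclidean_space)) set \<Rightarrow> ('a \<Rightarrow> ('a \<Rightarrow> real) \<Rightarrow> real) \<Rightarrow> bool" where
  "vector_field A X \<longleftrightarrow> (\<forall>p. X p \<in> tangent_space A p) \<and>
     (\<forall>f. smooth_fun A f \<longrightarrow> smooth_fun A (\<lambda>p. X p f))"

definition lie :: "('a::topological_space set \<times> ('a \<Rightarrow> 'n::euclidean_space)) set \<Rightarrow> ('a \<Rightarrow> ('a \<Rightarrow> real) \<Rightarrow> real) \<Rightarrow> ('a \<Rightarrow> ('a \<Rightarrow> real) \<Rightarrow> real) \<Rightarrow> 'a \<Rightarrow> ('a \<Rightarrow> real) \<Rightarrow> real" where
  "lie A X Y = (\<lambda>p f. if smooth_fun A f then X p (\<lambda>q. Y q f) - Y p (\<lambda>q. X q f) else 0)"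

type_synonym 'a tvec = "('a \<Rightarrow> real) \<Rightarrow> real"

definition sym_bilinear_field :: "('a::topological_space set \<times> ('a \<Rightarrow> 'n::euclidean_space)) set \<Rightarrow> ('a \<Rightarrow> 'a tvec \<Rightarrow> 'a tvec \<Rightarrow> real) \<Rightarrow> bool" where
  "sym_bilinear_field A g \<longleftrightarrow>
     (\<forall>p. \<forall>u\<in>tangent_space A p. \<forall>v\<in>tangent_space A p. g p u v = g p v u) \<and>
     (\<forall>p. \<forall>u\<in>tangent_space A p. \<forall>v\<in>tangent_space A p. \<forall>w\<in>tangent_space A p. \<forall>a b.
         g p (a *\<^sub>R u + b *\<^sub>R v) w = a * g p u w + b * g p v w) \<and>
     (\<forall>X Y. vector_field A X \<and> vector_field A Y \<longrightarrow> smooth_fun A (\<lambda>p. g p (X p) (Y p)))"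

definition singular_semi_riemannian ::
  "('a::{t2_space, second_countable_topology} set \<times> ('a \<Rightarrow> 'n::euclidean_space)) set \<Rightarrow> ('a \<Rightarrow> 'a tvec \<Rightarrow> 'a tvec \<Rightarrow> real) \<Rightarrow> bool" where
  "singular_semi_riemannian A g \<longleftrightarrow> smooth_manifold A \<and> sym_bilinear_field A g"

definition nullity_at :: "('a::topological_space set \<times> ('a \<Rightarrow> 'n::euclidean_space)) set \<Rightarrow> ('a \<Rightarrow> 'a tvec \<Rightarrow> 'a tvec \<Rightarrow> real) \<Rightarrow> 'a \<Rightarrow> nat" where
  "nullity_at A g p = dim {u \<in> tangent_space A p. \<forall>v\<in>tangent_space A p. g p u v = 0}"

definition pos_index_at :: "('a::topological_space set \<times> ('a \<Rightarrow> 'n::euclidean_space)) set \<Rightarrow> ('a \<Rightarrow> 'a tvec \<Rightarrow> 'a tvec \<Rightarrow> real) \<Rightarrow> 'a \<Rightarrow> nat" where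
  "pos_index_at A g p = (GREATEST k. \<exists>W. subspace W \<and> W \<subseteq> tangent_space A p \<and> dim W = k \<and>
                                  (\<forall>w\<in>W. w \<noteq> 0 \<longrightarrow> g p w w > 0))"

definition neg_index_at :: "('a::topological_space set \<times> ('a \<Rightarrow> 'n::euclidean_space)) set \<Rightarrow> ('a \<Rightarrow> 'a tvec \<Rightarrow> 'a tvec \<Rightarrow> real) \<Rightarrow> 'a \<Rightarrow> nat" where
  "neg_index_at A g p = (GREATEST k. \<exists>W. subspace W \<and> W \<subseteq> tangent_space A p \<and> dim W = k \<and>
                                  (\<forall>w\<in>W. w \<noteq> 0 \<longrightarrow> g p w w < 0))"

definition constant_signature :: "('a::topological_space set \<times> ('a \<Rightarrow> 'n::euclidean_space)) set \<Rightarrow> ('a \<Rightarrow> 'a tvec \<Rightarrow> 'a tvec \<Rightarrow> real) \<Rightarrow> bool" where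
  "constant_signature A g \<longleftrightarrow> (\<exists>r s t. \<forall>p.
      pos_index_at A g p = r \<and> neg_index_at A g p = s \<and> nullity_at A g p = t)"

definition koszul :: "('a::topological_space set \<times> ('a \<Rightarrow> 'n::euclidean_space)) set \<Rightarrow> ('a \<Rightarrow> 'a tvec \<Rightarrow> 'a tvec \<Rightarrow> real)
   \<Rightarrow> ('a \<Rightarrow> 'a tvec) \<Rightarrow> ('a \<Rightarrow> 'a tvec) \<Rightarrow> ('a \<Rightarrow> 'a tvec) \<Rightarrow> 'a \<Rightarrow> real" where
  "koszul A g X Y Z = (\<lambda>p. 1/2 * (
       X p (\<lambda>q. g q (Y q) (Z q)) + Y p (\<lambda>q. g q (Z q) (X q)) - Z p (\<lambda>q. g q (X q) (Y q))
     - g p (X p) (lie A Y Z p) + g p (Y p) (lie A Z X p) + g p (Z p) (lie A X Y p)))"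

definition nabla_flat :: "('a::topological_space set \<times> ('a \<Rightarrow> 'n::euclidean_space)) set \<Rightarrow> ('a \<Rightarrow> 'a tvec \<Rightarrow> 'a tvec \<Rightarrow> real)
   \<Rightarrow> ('a \<Rightarrow> 'a tvec) \<Rightarrow> ('a \<Rightarrow> 'a tvec) \<Rightarrow> ('a \<Rightarrow> 'a tvec) \<Rightarrow> 'a \<Rightarrow> real" where
  "nabla_flat A g X Y = (\<lambda>Z. koszul A g X Y Z)"

text \<open>Radical-stationary: for all X, Y and every point p, the covector (nabla-flat X Y)_p
  lies in the radical-annihilator, i.e. equals u-flat for some tangent vector u at p.\<close>
definition radical_stationary :: "('a::topological_space set \<times> ('a \<Rightarrow> 'n::euclidean_space)) set \<Rightarrow> ('a \<Rightarrow> 'a tvec \<Rightarrow> 'a tvec \<Rightarrow> real) \<Rightarrow> bool" where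
  "radical_stationary A g \<longleftrightarrow>
     (\<forall>X Y. vector_field A X \<and> vector_field A Y \<longrightarrow>
        (\<forall>p. \<exists>u\<in>tangent_space A p. \<forall>Z. vector_field A Z \<longrightarrow> nabla_flat A g X Y Z p = g p u (Z p)))"

definition flat_rep :: "('a::topological_space set \<times> ('a \<Rightarrow> 'n::euclidean_space)) set \<Rightarrow> ('a \<Rightarrow> 'a tvec \<Rightarrow> 'a tvec \<Rightarrow> real)
   \<Rightarrow> (('a \<Rightarrow> 'a tvec) \<Rightarrow> 'a \<Rightarrow> real) \<Rightarrow> 'a \<Rightarrow> 'a tvec" where
  "flat_rep A g \<omega> p = (SOME u. u \<in> tangent_space A p \<and>
       (\<forall>Z. vector_field A Z \<longrightarrow> \<omega> Z p = g p u (Z p)))"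

text \<open>The inner product on the radical-annihilator: \<langle>\<langle>u-flat, v-flat\<rangle>\<rangle> = g(u,v).\<close>
definition annih_inner :: "('a::topological_space set \<times> ('a \<Rightarrow> 'n::euclidean_space)) set \<Rightarrow> ('a \<Rightarrow> 'a tvec \<Rightarrow> 'a tvec \<Rightarrow> real)
   \<Rightarrow> (('a \<Rightarrow> 'a tvec) \<Rightarrow> 'a \<Rightarrow> real) \<Rightarrow> (('a \<Rightarrow> 'a tvec) \<Rightarrow> 'a \<Rightarrow> real) \<Rightarrow> 'a \<Rightarrow> real" where
  "annih_inner A g \<omega> \<eta> = (\<lambda>p. g p (flat_rep A g \<omega> p) (flat_rep A g \<eta> p))"

definition cov_form :: "('a::topological_space set \<times> ('a \<Rightarrow> 'n::euclidean_space)) set \<Rightarrow> ('a \<Rightarrow> 'a tvec \<Rightarrow> 'a tvec \<Rightarrow> real)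
   \<Rightarrow> ('a \<Rightarrow> 'a tvec) \<Rightarrow> (('a \<Rightarrow> 'a tvec) \<Rightarrow> 'a \<Rightarrow> real) \<Rightarrow> ('a \<Rightarrow> 'a tvec) \<Rightarrow> 'a \<Rightarrow> real" where
  "cov_form A g X \<omega> Y = (\<lambda>p. X p (\<omega> Y) - annih_inner A g (nabla_flat A g X Y) \<omega> p)"

definition riem :: "('a::topological_space set \<times> ('a \<Rightarrow> 'n::euclidean_space)) set \<Rightarrow> ('a \<Rightarrow> 'a tvec \<Rightarrow> 'a tvec \<Rightarrow> real)
   \<Rightarrow> ('a \<Rightarrow> 'a tvec) \<Rightarrow> ('a \<Rightarrow> 'a tvec) \<Rightarrow> ('a \<Rightarrow> 'a tvec) \<Rightarrow> ('a \<Rightarrow> 'a tvec) \<Rightarrow> 'a \<Rightarrow> real" where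
  "riem A g X Y Z T = (\<lambda>p.
       cov_form A g X (nabla_flat A g Y Z) T p - cov_form A g Y (nabla_flat A g X Z) T p
     - nabla_flat A g (lie A X Y) Z T p)"

definition koszul_derivative :: "('a::topological_space set \<times> ('a \<Rightarrow> 'n::euclidean_space)) set \<Rightarrow> ('a \<Rightarrow> 'a tvec \<Rightarrow> 'a tvec \<Rightarrow> real)
   \<Rightarrow> (('a \<Rightarrow> 'a tvec) \<Rightarrow> ('a \<Rightarrow> 'a tvec) \<Rightarrow> ('a \<Rightarrow> 'a tvec)) \<Rightarrow> bool" where
  "koszul_derivative A g nabla \<longleftrightarrow>
     (\<forall>X Y. vector_field A X \<and> vector_field A Y \<longrightarrow>
        vector_field A (nabla X Y) \<and>
        (\<forall>Z. vector_field A Z \<longrightarrow> (\<forall>p. g p (nabla X Y p) (Z p) = koszul A g X Y Z p)))"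

definition curv_nabla :: "('a::topological_space set \<times> ('a \<Rightarrow> 'n::euclidean_space)) set
   \<Rightarrow> (('a \<Rightarrow> 'a tvec) \<Rightarrow> ('a \<Rightarrow> 'a tvec) \<Rightarrow> ('a \<Rightarrow> 'a tvec))
   \<Rightarrow> ('a \<Rightarrow> 'a tvec) \<Rightarrow> ('a \<Rightarrow> 'a tvec) \<Rightarrow> ('a \<Rightarrow> 'a tvec) \<Rightarrow> ('a \<Rightarrow> 'a tvec)" where
  "curv_nabla A nabla X Y Z = (\<lambda>p.
       nabla X (nabla Y Z) p - nabla Y (nabla X Z) p - nabla (lie A X Y) Z p)"

end

theory Submission
  imports Defs
begin

text \<open>
  Metric compatibility of the Koszul form,
  \<open>K(X, W, T) + K(X, T, W) = X g(W, T)\<close>, applied to \<open>W = \<nabla>\<^sub>Y Z\<close>, gives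
  \<open>g(\<nabla>\<^sub>X \<nabla>\<^sub>Y Z, T) = X (K(Y, Z, T)) - g(\<nabla>\<^sub>X T, \<nabla>\<^sub>Y Z)\<close>, and the right-hand side is the
  covariant derivative of the form \<open>K(Y, Z, _)\<close> provided that \<open>\<langle>\<langle>K(X, T, _), K(Y, Z, _)\<rangle>\<rangle>\<close> equals
  \<open>g(\<nabla>\<^sub>X T, \<nabla>\<^sub>Y Z)\<close>.  The inner product is computed from arbitrary representatives \<open>u\<close> and \<open>w\<close>
  of the two forms, which are only known to agree with \<open>\<nabla>\<^sub>X T\<close> and \<open>\<nabla>\<^sub>Y Z\<close> when paired with
  values of vector fields; so the analytic core is that every tangent vector (a derivation of the
  global smooth functions) is the value of a vector field.  Hadamard's lemma and a bump function
  show that such a derivation is a combination of coordinate derivatives, which a cut-off extends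
  to the whole manifold.
\<close>

subsection \<open>Functions of class C^k\<close>

lemma has_real_derivative_line_shift:
  fixes y b :: "'a::real_vector"
  assumes "((\<lambda>s. f ((y + t *\<^sub>R b) + s *\<^sub>R b)) has_real_derivative d) (at 0)"
  shows "((\<lambda>s. f (y + s *\<^sub>R b)) has_real_derivative d) (at t)"
proof -
  have "y + t *\<^sub>R b + s *\<^sub>R b = y + (s + t) *\<^sub>R b" for s
    by (simp add: scaleR_add_left add_ac)
  with assms have "((\<lambda>s. f (y + (s + t) *\<^sub>R b)) has_real_derivative d) (at 0)"
    by simp
  then show ?thesis
    using DERIV_shift[of "\<lambda>s. f (y + s *\<^sub>R b)" d 0 t] by simp
qed

text \<open>The increment from \<open>x\<close> to \<open>x + h\<close> is split into moves along
  one coordinate at a time. On each move the mean value inequality compares the partial derivative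
  with its value at \<open>x\<close>, and continuity of the partials makes the error small relative
  to \<open>norm h\<close>.\<close>

lemma has_derivative_of_continuous_partials:
  fixes f :: "'n::euclidean_space \<Rightarrow> real"
  assumes "open U" "x \<in> U"
    and part: "\<And>b y. b \<in> Basis \<Longrightarrow> y \<in> U \<Longrightarrow>
      ((\<lambda>t. f (y + t *\<^sub>R b)) has_real_derivative D b y) (at 0)"
    and cont: "\<And>b. b \<in> Basis \<Longrightarrow> continuous_on U (D b)"
  shows "(f has_derivative (\<lambda>h. \<Sum>b\<in>Basis. (h \<bullet> b) * D b x)) (at x)"
proof -
  define N where "N = real DIM('n)"
  have N: "N > 0" "N \<ge> 1" by (auto simp: N_def Suc_le_eq)
  have main: "\<exists>d>0. \<forall>h. norm h < d \<longrightarrow>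
      norm (f (x + h) - f x - (\<Sum>b\<in>Basis. (h \<bullet> b) * D b x)) \<le> e * norm h" if "e > 0" for e
  proof -
    \<comment> \<open>There are \<open>N\<close> coordinate moves, each with error at most
      \<open>e' * norm h\<close>, which add up to \<open>e * norm h\<close>.\<close>
    define e' where "e' = e / N"
    have e': "e' > 0" using that N by (simp add: e'_def)
    have "\<forall>\<^sub>F y in at x. \<forall>b\<in>Basis. dist (D b y) (D b x) < e'"
    proof (rule eventually_ball_finite[OF finite_Basis], rule)
      fix b :: 'n assume "b \<in> Basis"
      then have "isCont (D b) x"
        using cont assms(1,2) continuous_on_eq_continuous_at by blast
      then show "\<forall>\<^sub>F y in at x. dist (D b y) (D b x) < e'"
        using e' unfolding isCont_def by (rule tendstoD)
    qed
    moreover have "\<forall>\<^sub>F y in at x. y \<in> U"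
      using assms(1,2) eventually_at_topological by blast
    ultimately have "\<forall>\<^sub>F y in at x. y \<in> U \<and> (\<forall>b\<in>Basis. dist (D b y) (D b x) < e')"
      by eventually_elim auto
    then obtain d where d: "d > 0"
      and d': "\<And>y. y \<noteq> x \<Longrightarrow> dist y x < d \<Longrightarrow> y \<in> U \<and> (\<forall>b\<in>Basis. dist (D b y) (D b x) < e')"
      unfolding eventually_at by blast
    have dU: "y \<in> U \<and> (\<forall>b\<in>Basis. dist (D b y) (D b x) < e')" if "dist y x < d" for y
      using d'[OF _ that] assms(2) e' by (cases "y = x") auto
    have "norm (f (x + h) - f x - (\<Sum>b\<in>Basis. (h \<bullet> b) * D b x)) \<le> e * norm h"
      if h: "norm h < d / N" for h
    proof -
      \<comment> \<open>An intermediate point is reached by at most \<open>N\<close> moves of length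
        at most \<open>norm h\<close> each; hence the requirement
        \<open>norm h < d / N\<close>.\<close>
      have near: "dist (x + ((\<Sum>b\<in>S. (h \<bullet> b) *\<^sub>R b) + t *\<^sub>R c)) x < d"
        if S: "insert c S \<subseteq> Basis" "c \<notin> S" and t: "\<bar>t\<bar> \<le> \<bar>h \<bullet> c\<bar>" for S c t
      proof -
        have fin: "finite S" using S finite_subset[OF _ finite_Basis] by auto
        have "norm ((\<Sum>b\<in>S. (h \<bullet> b) *\<^sub>R b) + t *\<^sub>R c) \<le> (\<Sum>b\<in>S. norm ((h \<bullet> b) *\<^sub>R b)) + norm (t *\<^sub>R c)"
          by (rule order_trans[OF norm_triangle_ineq add_right_mono[OF norm_sum]])
        also have "\<dots> \<le> (\<Sum>b\<in>S. norm h) + norm h"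
        proof (intro add_mono sum_mono)
          show "norm ((h \<bullet> b) *\<^sub>R b) \<le> norm h" if "b \<in> S" for b
            using that S Basis_le_norm[of b h] by auto
          show "norm (t *\<^sub>R c) \<le> norm h"
            using S t Basis_le_norm[of c h] by auto
        qed
        also have "\<dots> = real (card (insert c S)) * norm h"
          using fin S by (simp add: algebra_simps)
        also have "\<dots> \<le> N * norm h"
          unfolding N_def using S by (intro mult_right_mono of_nat_mono card_mono) auto
        also have "\<dots> < d" using h N by (simp add: field_simps)
        finally show ?thesis by (simp add: dist_norm)
      qed
      have "norm (f (x + (\<Sum>b\<in>S. (h \<bullet> b) *\<^sub>R b)) - f x - (\<Sum>b\<in>S. (h \<bullet> b) * D b x))
          \<le> real (card S) * (e' * norm h)" if "finite S" "S \<subseteq> Basis" for S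
        using that
      proof (induction S rule: finite_induct)
        case (insert c S)
        define y where "y = x + (\<Sum>b\<in>S. (h \<bullet> b) *\<^sub>R b)"
        define \<psi> where "\<psi> t = f (y + t *\<^sub>R c) - t * D c x" for t
        have c: "c \<in> Basis" using insert by auto
        have seg: "dist (y + t *\<^sub>R c) x < d" if "t \<in> closed_segment 0 (h \<bullet> c)" for t
        proof -
          have "\<bar>t\<bar> \<le> \<bar>h \<bullet> c\<bar>" using that by (auto simp: closed_segment_eq_real_ivl split: if_splits)
          then show ?thesis
            using near[of c S t] insert by (simp add: y_def add.assoc)
        qed
        have der: "(\<psi> has_real_derivative (D c (y + t *\<^sub>R c) - D c x)) (at t within closed_segment 0 (h \<bullet> c))"
          if "t \<in> closed_segment 0 (h \<bullet> c)" for t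
        proof -
          have "((\<lambda>s. f (y + s *\<^sub>R c)) has_real_derivative D c (y + t *\<^sub>R c)) (at t)"
            by (rule has_real_derivative_line_shift, rule part[OF c]) (use dU[OF seg[OF that]] in blast)
          then have "(\<psi> has_real_derivative (D c (y + t *\<^sub>R c) - D c x)) (at t)"
            unfolding \<psi>_def by (auto intro!: derivative_eq_intros)
          then show ?thesis by (rule has_field_derivative_at_within)
        qed
        have "norm (\<psi> (h \<bullet> c) - \<psi> 0) \<le> e' * norm (h \<bullet> c - 0)"
        proof (rule field_differentiable_bound[OF convex_closed_segment der])
          show "norm (D c (y + t *\<^sub>R c) - D c x) \<le> e'" if "t \<in> closed_segment 0 (h \<bullet> c)" for t
            using dU[OF seg[OF that]] c by (auto simp: dist_norm intro: less_imp_le)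
        qed auto
        also have "\<dots> \<le> e' * norm h"
          using e' Basis_le_norm[OF c, of h] by simp
        finally have 1: "norm (f (y + (h \<bullet> c) *\<^sub>R c) - f y - (h \<bullet> c) * D c x) \<le> e' * norm h"
          by (simp add: \<psi>_def algebra_simps)
        have 2: "norm (f y - f x - (\<Sum>b\<in>S. (h \<bullet> b) * D b x)) \<le> real (card S) * (e' * norm h)"
          using insert by (simp add: y_def)
        have E: "x + (\<Sum>b\<in>insert c S. (h \<bullet> b) *\<^sub>R b) = y + (h \<bullet> c) *\<^sub>R c"
          using insert by (simp add: y_def algebra_simps)
        have S: "(\<Sum>b\<in>insert c S. (h \<bullet> b) * D b x) = (h \<bullet> c) * D c x + (\<Sum>b\<in>S. (h \<bullet> b) * D b x)"
          using insert by simp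
        have "norm (f (x + (\<Sum>b\<in>insert c S. (h \<bullet> b) *\<^sub>R b)) - f x - (\<Sum>b\<in>insert c S. (h \<bullet> b) * D b x))
           = norm ((f (y + (h \<bullet> c) *\<^sub>R c) - f y - (h \<bullet> c) * D c x) + (f y - f x - (\<Sum>b\<in>S. (h \<bullet> b) * D b x)))"
          unfolding E S by (simp add: algebra_simps)
        also have "\<dots> \<le> e' * norm h + real (card S) * (e' * norm h)"
          by (rule order_trans[OF norm_triangle_ineq add_mono[OF 1 2]])
        finally show ?case using insert by (simp add: algebra_simps)
      qed simp
      from this[of Basis] show ?thesis
        using N by (simp add: euclidean_representation e'_def N_def)
    qed
    then show ?thesis using d N by (intro exI[of _ "d / N"]) auto
  qed
  show ?thesis
    unfolding has_derivative_at_alt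
  proof (intro conjI allI impI)
    show "bounded_linear (\<lambda>h. \<Sum>b\<in>Basis. (h \<bullet> b) * D b x)"
      by (intro bounded_linear_intros)
    fix e :: real assume "e > 0"
    from main[OF this] obtain d where "d > 0" and
      d: "\<And>h. norm h < d \<Longrightarrow> norm (f (x + h) - f x - (\<Sum>b\<in>Basis. (h \<bullet> b) * D b x)) \<le> e * norm h"
      by blast
    then show "\<exists>d>0. \<forall>y. norm (y - x) < d \<longrightarrow>
        norm (f y - f x - (\<Sum>b\<in>Basis. ((y - x) \<bullet> b) * D b x)) \<le> e * norm (y - x)"
      using d[of "y - x" for y] by auto
  qed
qed

lemma has_derivative_imp_partial:
  assumes "(f has_derivative f') (at x)"
  shows "((\<lambda>t. f (x + t *\<^sub>R b)) has_real_derivative f' b) (at 0)"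
proof -
  have "((\<lambda>t. f (x + t *\<^sub>R b)) has_derivative (\<lambda>t. f' (t *\<^sub>R b))) (at 0)"
    by (rule has_derivative_compose[where f = "\<lambda>t. x + t *\<^sub>R b"])
      (use assms in \<open>auto intro!: derivative_eq_intros\<close>)
  moreover have "(\<lambda>t. f' (t *\<^sub>R b)) = (*) (f' b)"
    using has_derivative_linear[OF assms] by (simp add: linear_scale fun_eq_iff mult.commute)
  ultimately show ?thesis by (simp add: has_field_derivative_def)
qed

text \<open>Unlike \<^const>\<open>smooth_on\<close>, this asks for a total derivative at each order, which makes
  the product and chain rules available; \<open>smooth_on_iff_Ck_on\<close> relates the two.\<close>
primrec Ck_on :: "nat \<Rightarrow> 'n::euclidean_space set \<Rightarrow> ('n \<Rightarrow> real) \<Rightarrow> bool" where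
  "Ck_on 0 U f \<longleftrightarrow> continuous_on U f"
| "Ck_on (Suc k) U f \<longleftrightarrow> (\<exists>D. (\<forall>x\<in>U. (f has_derivative (\<lambda>h. \<Sum>b\<in>Basis. (h \<bullet> b) * D b x)) (at x)) \<and>
     (\<forall>b\<in>Basis. Ck_on k U (D b)))"

lemma Ck_on_imp_continuous_on: "Ck_on k U f \<Longrightarrow> continuous_on U f"
  by (cases k) (auto intro!: continuous_at_imp_continuous_on dest!: has_derivative_continuous)

lemma Ck_on_decrease: "Ck_on (Suc k) U f \<Longrightarrow> Ck_on k U f"
proof (induction k arbitrary: f)
  case 0 then show ?case using Ck_on_imp_continuous_on by (metis Ck_on.simps(1))
next
  case (Suc k)
  then obtain D where "\<forall>x\<in>U. (f has_derivative (\<lambda>h. \<Sum>b\<in>Basis. (h \<bullet> b) * D b x)) (at x)"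
    "\<forall>b\<in>Basis. Ck_on (Suc k) U (D b)" by (subst (asm) Ck_on.simps) blast
  with Suc.IH show ?case unfolding Ck_on.simps(2)[of k] by blast
qed

text \<open>Derivatives are taken in the whole space, so openness of \<open>U\<close> is what lets
  agreement on \<open>U\<close> transfer them.\<close>

lemma Ck_on_cong:
  assumes "open U" "\<And>x. x \<in> U \<Longrightarrow> f x = g x"
  shows "Ck_on k U f \<longleftrightarrow> Ck_on k U g"
proof (cases k)
  case 0 then show ?thesis using assms by (simp cong: continuous_on_cong)
next
  case (Suc m)
  have "(f has_derivative D) (at x) \<longleftrightarrow> (g has_derivative D) (at x)" if "x \<in> U" for D x
    using has_derivative_transform_within_open[of f D x UNIV U g]
      has_derivative_transform_within_open[of g D x UNIV U f] assms that by auto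
  then show ?thesis using Suc by auto
qed

lemma Ck_on_SucI:
  assumes "open U"
    and "\<And>b x. b \<in> Basis \<Longrightarrow> x \<in> U \<Longrightarrow> ((\<lambda>t. f (x + t *\<^sub>R b)) has_real_derivative D b x) (at 0)"
    and "\<And>b. b \<in> Basis \<Longrightarrow> Ck_on k U (D b)"
  shows "Ck_on (Suc k) U f"
  unfolding Ck_on.simps
proof (intro exI[of _ D] conjI ballI)
  fix x assume "x \<in> U"
  then show "(f has_derivative (\<lambda>h. \<Sum>b\<in>Basis. (h \<bullet> b) * D b x)) (at x)"
    using assms by (intro has_derivative_of_continuous_partials[of U]) (auto intro: Ck_on_imp_continuous_on)
qed (fact assms(3))

lemma Ck_on_SucE:
  assumes "Ck_on (Suc k) U f"
  obtains D where "\<And>x. x \<in> U \<Longrightarrow> (f has_derivative (\<lambda>h. \<Sum>b\<in>Basis. (h \<bullet> b) * D b x)) (at x)"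
    "\<And>b. b \<in> Basis \<Longrightarrow> Ck_on k U (D b)"
  using assms by auto

lemma Ck_on_Suc_partialsE:
  assumes "Ck_on (Suc k) U f"
  obtains D where "\<And>b. b \<in> Basis \<Longrightarrow> Ck_on k U (D b)"
    "\<And>b x. b \<in> Basis \<Longrightarrow> x \<in> U \<Longrightarrow> ((\<lambda>t. f (x + t *\<^sub>R b)) has_real_derivative D b x) (at 0)"
proof -
  obtain D where D: "\<And>x. x \<in> U \<Longrightarrow> (f has_derivative (\<lambda>h. \<Sum>b\<in>Basis. (h \<bullet> b) * D b x)) (at x)"
    "\<And>b. b \<in> Basis \<Longrightarrow> Ck_on k U (D b)" using assms by (rule Ck_on_SucE) blast
  have "((\<lambda>t. f (x + t *\<^sub>R b)) has_real_derivative D b x) (at 0)" if "b \<in> Basis" "x \<in> U" for b x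
  proof -
    have "(\<Sum>c\<in>Basis. (b \<bullet> c) * D c x) = (\<Sum>c\<in>Basis. if c = b then D c x else 0)"
      using that by (intro sum.cong) (auto simp: inner_Basis)
    then show ?thesis
      using has_derivative_imp_partial[OF D(1)[OF that(2)], of b] that by simp
  qed
  with D that show ?thesis by blast
qed

lemma smooth_on_dir_deriv:
  assumes "smooth_on U f" "b \<in> Basis"
  shows "smooth_on U (dir_deriv b f)"
proof -
  have "iter_dd bs (dir_deriv b f) = iter_dd (bs @ [b]) f" for bs
    by (induction bs) auto
  moreover have "set (bs @ [b]) \<subseteq> Basis" if "set bs \<subseteq> Basis" for bs
    using that assms by simp
  ultimately show ?thesis using assms unfolding smooth_on_def by simp
qed

lemma smooth_on_has_partial:
  assumes "smooth_on U f" "b \<in> Basis" "x \<in> U"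
  shows "((\<lambda>t. f (x + t *\<^sub>R b)) has_real_derivative dir_deriv b f x) (at 0)"
proof -
  have "(\<lambda>t. f (x + t *\<^sub>R b)) differentiable (at 0)"
    using assms unfolding smooth_on_def by (auto dest: spec[of _ "[]"])
  then show ?thesis unfolding dir_deriv_def
    using DERIV_deriv_iff_real_differentiable by blast
qed

lemma smooth_on_has_derivative:
  assumes "smooth_on U f" "open U" "x \<in> U"
  shows "(f has_derivative (\<lambda>h. \<Sum>b\<in>Basis. (h \<bullet> b) * dir_deriv b f x)) (at x)"
proof (rule has_derivative_of_continuous_partials[OF assms(2,3)])
  show "continuous_on U (dir_deriv b f)" if "b \<in> Basis" for b
    using smooth_on_dir_deriv[OF assms(1) that] unfolding smooth_on_def
    by (auto dest: spec[of _ "[]"])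
qed (rule smooth_on_has_partial[OF assms(1)])

text \<open>One direction is an induction on \<open>k\<close>, the other on the list of directions.
  As \<open>deriv\<close> is total, \<open>dir_deriv\<close> is known to agree with the partials
  supplied by \<open>Ck_on\<close> only at points of \<open>U\<close>; \<open>Ck_on_cong\<close>
  bridges this.\<close>

lemma smooth_on_iff_Ck_on:
  assumes "open U"
  shows "smooth_on U f \<longleftrightarrow> (\<forall>k. Ck_on k U f)"
proof
  have "Ck_on k U f" if "smooth_on U f" for k
    using that
  proof (induction k arbitrary: f)
    case 0
    then show ?case unfolding smooth_on_def by (auto dest: spec[of _ "[]"])
  next
    case (Suc k)
    show ?case
      by (rule Ck_on_SucI[OF assms smooth_on_has_partial]) (auto intro: Suc smooth_on_dir_deriv)
  qed
  then show "smooth_on U f \<Longrightarrow> \<forall>k. Ck_on k U f" by blast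
next
  assume f: "\<forall>k. Ck_on k U f"
  \<comment> \<open>Each differentiation costs one order, so only the statement for all
    \<open>k\<close> at once can be iterated along the list.\<close>
  have step: "(\<forall>k. Ck_on k U (dir_deriv b g)) \<and> (\<forall>x\<in>U. (\<lambda>t. g (x + t *\<^sub>R b)) differentiable (at 0))"
    if g: "\<forall>k. Ck_on k U g" and b: "b \<in> Basis" for g b
  proof (intro conjI allI)
    fix k
    from g have "Ck_on (Suc k) U g" by blast
    then obtain D where D: "\<And>b. b \<in> Basis \<Longrightarrow> Ck_on k U (D b)"
      "\<And>b x. b \<in> Basis \<Longrightarrow> x \<in> U \<Longrightarrow> ((\<lambda>t. g (x + t *\<^sub>R b)) has_real_derivative D b x) (at 0)"
      by (rule Ck_on_Suc_partialsE) blast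
    have "dir_deriv b g x = D b x" if "x \<in> U" for x
      unfolding dir_deriv_def using D(2)[OF b that] by (rule DERIV_imp_deriv)
    then show "Ck_on k U (dir_deriv b g)" using D(1)[OF b] Ck_on_cong[OF assms] by blast
  next
    from g have "Ck_on (Suc 0) U g" by blast
    then show "\<forall>x\<in>U. (\<lambda>t. g (x + t *\<^sub>R b)) differentiable (at 0)"
      by (rule Ck_on_Suc_partialsE) (use b in \<open>auto simp: real_differentiable_def\<close>)
  qed
  have iter: "\<forall>k. Ck_on k U (iter_dd bs f)" if "set bs \<subseteq> Basis" for bs
    using that by (induction bs) (use f step in auto)
  show "smooth_on U f"
    unfolding smooth_on_def using iter step Ck_on_imp_continuous_on by blast
qed

section \<open>Closure properties and locality of C^k functions\<close>

lemma Ck_on_const: "Ck_on k U (\<lambda>x. c)"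
proof (induction k arbitrary: c)
  case (Suc k)
  then show ?case by (auto intro!: exI[of _ "\<lambda>_ _. 0"])
qed simp

lemma Ck_on_add: "Ck_on k U f \<Longrightarrow> Ck_on k U g \<Longrightarrow> Ck_on k U (\<lambda>x. f x + g x)"
proof (induction k arbitrary: f g)
  case (Suc k)
  from Suc.prems(1) obtain D where D: "\<And>x. x \<in> U \<Longrightarrow> (f has_derivative (\<lambda>h. \<Sum>b\<in>Basis. (h \<bullet> b) * D b x)) (at x)"
    "\<And>b. b \<in> Basis \<Longrightarrow> Ck_on k U (D b)" by (rule Ck_on_SucE) blast
  from Suc.prems(2) obtain E where E: "\<And>x. x \<in> U \<Longrightarrow> (g has_derivative (\<lambda>h. \<Sum>b\<in>Basis. (h \<bullet> b) * E b x)) (at x)"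
    "\<And>b. b \<in> Basis \<Longrightarrow> Ck_on k U (E b)" by (rule Ck_on_SucE) blast
  have "((\<lambda>x. f x + g x) has_derivative (\<lambda>h. \<Sum>b\<in>Basis. (h \<bullet> b) * (D b x + E b x))) (at x)" if "x \<in> U" for x
    by (rule has_derivative_eq_rhs[OF has_derivative_add[OF D(1) E(1)]])
      (use that in \<open>auto simp: sum.distrib distrib_left\<close>)
  then show ?case using Suc.IH[OF D(2) E(2)] by (auto intro!: exI[of _ "\<lambda>b x. D b x + E b x"])
qed (auto intro: continuous_intros)

lemma Ck_on_mult: "Ck_on k U f \<Longrightarrow> Ck_on k U g \<Longrightarrow> Ck_on k U (\<lambda>x. f x * g x)"
proof (induction k arbitrary: f g)
  case (Suc k)
  from Suc.prems(1) obtain D where D: "\<And>x. x \<in> U \<Longrightarrow> (f has_derivative (\<lambda>h. \<Sum>b\<in>Basis. (h \<bullet> b) * D b x)) (at x)"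
    "\<And>b. b \<in> Basis \<Longrightarrow> Ck_on k U (D b)" by (rule Ck_on_SucE) blast
  from Suc.prems(2) obtain E where E: "\<And>x. x \<in> U \<Longrightarrow> (g has_derivative (\<lambda>h. \<Sum>b\<in>Basis. (h \<bullet> b) * E b x)) (at x)"
    "\<And>b. b \<in> Basis \<Longrightarrow> Ck_on k U (E b)" by (rule Ck_on_SucE) blast
  have "((\<lambda>x. f x * g x) has_derivative (\<lambda>h. \<Sum>b\<in>Basis. (h \<bullet> b) * (f x * E b x + D b x * g x))) (at x)"
    if "x \<in> U" for x
    by (rule has_derivative_eq_rhs[OF has_derivative_mult[OF D(1) E(1)]])
      (use that in \<open>auto simp: sum.distrib distrib_left sum_distrib_left sum_distrib_right algebra_simps\<close>)
  \<comment> \<open>The product rule keeps \<open>f\<close> and \<open>g\<close> undifferentiated,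
    so both are first lowered to order \<open>k\<close>.\<close>
  moreover have "Ck_on k U (\<lambda>x. f x * E b x + D b x * g x)" if "b \<in> Basis" for b
    using Suc.prems[THEN Ck_on_decrease] that D(2) E(2) by (intro Ck_on_add Suc.IH)
  ultimately show ?case by (auto intro!: exI[of _ "\<lambda>b x. f x * E b x + D b x * g x"])
qed (auto intro: continuous_intros)

lemma Ck_on_sum: "(\<And>i. i \<in> I \<Longrightarrow> Ck_on k U (f i)) \<Longrightarrow> Ck_on k U (\<lambda>x. \<Sum>i\<in>I. f i x)"
  by (induction I rule: infinite_finite_induct) (auto intro: Ck_on_const Ck_on_add)

text \<open>By the chain rule the partials are sums of products of partials of the components with
  composites \<open>D i (\<Phi> x)\<close>. These composites have order \<open>k\<close>, so the
  induction runs over all outer functions while \<open>\<Phi>\<close> stays fixed.\<close>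

lemma Ck_on_compose:
  fixes F :: "'m::euclidean_space \<Rightarrow> real" and \<Phi> :: "'n::euclidean_space \<Rightarrow> 'm"
  assumes "Ck_on k W F" "\<And>i. i \<in> Basis \<Longrightarrow> Ck_on k U (\<lambda>x. \<Phi> x \<bullet> i)" "\<Phi> ` U \<subseteq> W"
  shows "Ck_on k U (\<lambda>x. F (\<Phi> x))"
  using assms
proof (induction k arbitrary: F)
  case 0
  have "continuous_on U \<Phi>"
    using 0 by (subst continuous_on_componentwise) auto
  then show ?case using 0 by (auto intro: continuous_on_compose2)
next
  case (Suc k)
  from Suc.prems(1) obtain D where D: "\<And>x. x \<in> W \<Longrightarrow> (F has_derivative (\<lambda>h. \<Sum>b\<in>Basis. (h \<bullet> b) * D b x)) (at x)"
    "\<And>b. b \<in> Basis \<Longrightarrow> Ck_on k W (D b)" by (rule Ck_on_SucE) blast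
  \<comment> \<open>Bundling both properties of the partials into one predicate lets a single choice
    yield a family \<open>E i\<close> for all components.\<close>
  define P where "P i E \<longleftrightarrow> (\<forall>x\<in>U. ((\<lambda>x. \<Phi> x \<bullet> i) has_derivative (\<lambda>h. \<Sum>b\<in>Basis. (h \<bullet> b) * E b x)) (at x)) \<and>
      (\<forall>b\<in>Basis. Ck_on k U (E b))" for i E
  have "\<forall>i\<in>Basis. \<exists>E. P i E"
    using Suc.prems(2) by (simp add: P_def)
  then obtain E where "\<forall>i\<in>Basis. P i (E i)" by (rule bchoice[THEN exE])
  then have E: "\<And>i x. i \<in> Basis \<Longrightarrow> x \<in> U \<Longrightarrow> ((\<lambda>x. \<Phi> x \<bullet> i) has_derivative (\<lambda>h. \<Sum>b\<in>Basis. (h \<bullet> b) * E i b x)) (at x)"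
    "\<And>i b. i \<in> Basis \<Longrightarrow> b \<in> Basis \<Longrightarrow> Ck_on k U (E i b)"
    unfolding P_def by blast+
  have "((\<lambda>x. F (\<Phi> x)) has_derivative (\<lambda>h. \<Sum>b\<in>Basis. (h \<bullet> b) * (\<Sum>i\<in>Basis. E i b x * D i (\<Phi> x)))) (at x)"
    if x: "x \<in> U" for x
  proof -
    \<comment> \<open>The total derivative of \<open>\<Phi>\<close>, assembled from those of its
      components.\<close>
    define L where "L h = (\<Sum>i\<in>Basis. (\<Sum>b\<in>Basis. (h \<bullet> b) * E i b x) *\<^sub>R i)" for h
    have Li: "L h \<bullet> i = (\<Sum>b\<in>Basis. (h \<bullet> b) * E i b x)" if "i \<in> Basis" for h i
      unfolding L_def using that by simp
    have "(\<Phi> has_derivative L) (at x)"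
      using E(1) x Li by (subst has_derivative_componentwise_within) auto
    then have "((\<lambda>x. F (\<Phi> x)) has_derivative (\<lambda>h. \<Sum>i\<in>Basis. (L h \<bullet> i) * D i (\<Phi> x))) (at x)"
      by (rule has_derivative_compose, intro D(1)) (use x Suc.prems(3) in blast)
    moreover have "(\<Sum>i\<in>Basis. (L h \<bullet> i) * D i (\<Phi> x)) = (\<Sum>b\<in>Basis. (h \<bullet> b) * (\<Sum>i\<in>Basis. E i b x * D i (\<Phi> x)))" for h
    proof -
      have "(\<Sum>i\<in>Basis. (L h \<bullet> i) * D i (\<Phi> x)) = (\<Sum>i\<in>Basis. \<Sum>b\<in>Basis. (h \<bullet> b) * (E i b x * D i (\<Phi> x)))"
        by (simp add: Li sum_distrib_right mult.assoc)
      also have "\<dots> = (\<Sum>b\<in>Basis. \<Sum>i\<in>Basis. (h \<bullet> b) * (E i b x * D i (\<Phi> x)))" by (rule sum.swap)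
      finally show ?thesis by (simp add: sum_distrib_left)
    qed
    ultimately show ?thesis by simp
  qed
  moreover have "Ck_on k U (\<lambda>x. \<Sum>i\<in>Basis. E i b x * D i (\<Phi> x))" if "b \<in> Basis" for b
  proof (intro Ck_on_sum Ck_on_mult E(2) that)
    show "Ck_on k U (\<lambda>x. D i (\<Phi> x))" if "i \<in> Basis" for i
      by (rule Suc.IH[OF D(2)[OF that] Ck_on_decrease[OF Suc.prems(2)] Suc.prems(3)])
  qed
  ultimately show ?case
    unfolding Ck_on.simps by (intro exI[of _ "\<lambda>b x. \<Sum>i\<in>Basis. E i b x * D i (\<Phi> x)"]) blast
qed

lemma Ck_on_inner: "Ck_on k U (\<lambda>x. x \<bullet> c)"
proof (cases k)
  case (Suc m)
  have "((\<lambda>x. x \<bullet> c) has_derivative (\<lambda>h. \<Sum>b\<in>Basis. (h \<bullet> b) * (b \<bullet> c))) (at x)" for x :: 'a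
  proof -
    have eq: "(\<lambda>h. \<Sum>b\<in>Basis. (h \<bullet> b) * (b \<bullet> c)) = (\<lambda>h::'a. h \<bullet> c)"
      by (rule ext, subst (3) euclidean_inner) (simp add: inner_commute)
    show ?thesis
      unfolding eq by (rule bounded_linear_imp_has_derivative[OF bounded_linear_inner_left])
  qed
  then show ?thesis using Suc Ck_on_const by (auto intro!: exI[of _ "\<lambda>b x. b \<bullet> c"])
qed (auto intro: continuous_intros)

text \<open>The local families of partials depend on the neighbourhood. Choosing
  \<open>dir_deriv b f\<close> as the candidate glues them, since it equals the local partial
  wherever one exists.\<close>

lemma Ck_on_locally:
  assumes "\<And>x. x \<in> U \<Longrightarrow> \<exists>V. open V \<and> x \<in> V \<and> Ck_on k V f" "open U"
  shows "Ck_on k U f"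
  using assms(1)
proof (induction k arbitrary: f)
  case 0
  have "isCont f x" if "x \<in> U" for x
    using 0[OF that] by (auto simp: continuous_on_eq_continuous_at)
  then show ?case by (simp add: continuous_at_imp_continuous_on)
next
  case (Suc k)
  have part: "((\<lambda>t. f (x + t *\<^sub>R b)) has_real_derivative dir_deriv b f x) (at 0) \<and>
     (\<exists>V. open V \<and> x \<in> V \<and> Ck_on k V (dir_deriv b f))"
    if x: "x \<in> U" and b: "b \<in> Basis" for x b
  proof -
    obtain V where V: "open V" "x \<in> V" "Ck_on (Suc k) V f" using Suc.prems x by blast
    from V(3) obtain D where D: "\<And>b. b \<in> Basis \<Longrightarrow> Ck_on k V (D b)"
      "\<And>b x. b \<in> Basis \<Longrightarrow> x \<in> V \<Longrightarrow> ((\<lambda>t. f (x + t *\<^sub>R b)) has_real_derivative D b x) (at 0)"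
      by (rule Ck_on_Suc_partialsE) blast
    have eq: "dir_deriv b f x = D b x" if "x \<in> V" for x
      unfolding dir_deriv_def using D(2)[OF b that] by (rule DERIV_imp_deriv)
    then have "Ck_on k V (dir_deriv b f)" using D(1)[OF b] Ck_on_cong[OF V(1)] by blast
    then show ?thesis using D(2)[OF b V(2)] eq[OF V(2)] V by auto
  qed
  show ?case
    by (rule Ck_on_SucI[OF assms(2)]) (use part Suc.IH in blast)+
qed

subsection \<open>Bump functions and Hadamard's lemma\<close>

text \<open>The derivative of \<open>flat_exp n\<close> is a linear combination of \<open>flat_exp (n + 1)\<close> and
  \<open>flat_exp (n + 2)\<close>, so the whole family is smooth as soon as each member is differentiable.\<close>
definition flat_exp :: "nat \<Rightarrow> real \<Rightarrow> real" where
  "flat_exp n x = (if x > 0 then inverse x ^ n * exp (- inverse x) else 0)"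

lemma flat_exp_tendsto_0: "(flat_exp n \<longlongrightarrow> 0) (at 0)"
proof (rule filterlim_split_at)
  have "eventually (\<lambda>x. flat_exp n x = 0) (at_left 0)"
    by (auto simp: flat_exp_def eventually_at_filter)
  then show "(flat_exp n \<longlongrightarrow> 0) (at_left 0)" by (rule tendsto_eventually)
  have "((\<lambda>x. inverse x ^ n / exp (inverse x)) \<longlongrightarrow> (0::real)) (at_right 0)"
    by (rule filterlim_compose[OF tendsto_power_div_exp_0 filterlim_inverse_at_top_right])
  moreover have "eventually (\<lambda>x. inverse x ^ n / exp (inverse x) = flat_exp n x) (at_right 0)"
    by (auto simp: flat_exp_def eventually_at_filter exp_minus divide_inverse)
  ultimately show "(flat_exp n \<longlongrightarrow> 0) (at_right 0)" by (rule Lim_transform_eventually)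
qed

lemma flat_exp_has_derivative:
  "(flat_exp n has_real_derivative (flat_exp (n + 2) x - real n * flat_exp (n + 1) x)) (at x)"
proof (cases x "0::real" rule: linorder_cases)
  case less
  have "((\<lambda>_. 0) has_real_derivative 0) (at x)" by simp
  then have "(flat_exp n has_real_derivative 0) (at x)"
    by (rule has_field_derivative_transform_within_open[of _ _ _ "{..<0}"])
      (use less in \<open>auto simp: flat_exp_def\<close>)
  then show ?thesis using less by (simp add: flat_exp_def)
next
  case equal
  \<comment> \<open>At the origin the difference quotient of \<open>flat_exp n\<close> is exactly
    \<open>flat_exp (Suc n)\<close>, whose limit is already known.\<close>
  have "((\<lambda>y. (flat_exp n y - flat_exp n 0) / (y - 0)) \<longlongrightarrow> 0) (at 0)"
  proof (rule Lim_transform_eventually[OF flat_exp_tendsto_0[of "Suc n"]])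
    show "\<forall>\<^sub>F y in at 0. flat_exp (Suc n) y = (flat_exp n y - flat_exp n 0) / (y - 0)"
      by (auto simp: flat_exp_def eventually_at_filter divide_inverse)
  qed
  then show ?thesis using equal
    by (simp add: has_field_derivative_iff flat_exp_def)
next
  case greater
  have "((\<lambda>x. inverse x ^ n * exp (- inverse x)) has_real_derivative
      (flat_exp (n + 2) x - real n * flat_exp (n + 1) x)) (at x)"
  proof (cases n)
    case 0
    then show ?thesis using greater
      by (auto intro!: derivative_eq_intros simp: flat_exp_def power2_eq_square)
  next
    case (Suc m)
    \<comment> \<open>Differentiating the power produces the exponent \<open>m - Suc 0\<close>; the
      case of truncated subtraction is separated so that the powers recombine.\<close>
    have "m = 0 \<or> inverse x ^ m = inverse x * inverse x ^ (m - Suc 0)"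
      by (cases m) auto
    with Suc show ?thesis using greater
      by (auto intro!: derivative_eq_intros simp: flat_exp_def power2_eq_square algebra_simps)
  qed
  then show ?thesis
    by (rule has_field_derivative_transform_within_open[of _ _ _ "{0<..}"])
      (use greater in \<open>auto simp: flat_exp_def\<close>)
qed

lemma Ck_on_flat_exp: "Ck_on k UNIV (flat_exp n)"
proof (induction k arbitrary: n)
  case 0
  then show ?case
    unfolding Ck_on.simps by (rule DERIV_continuous_on[OF has_field_derivative_at_within[OF flat_exp_has_derivative]])
next
  case (Suc k)
  show ?case
  proof (rule Ck_on_SucI)
    fix b x :: real assume "b \<in> Basis"
    then show "((\<lambda>t. flat_exp n (x + t *\<^sub>R b)) has_real_derivative
        flat_exp (n + 2) x + (- real n) * flat_exp (n + 1) x) (at 0)"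
      using DERIV_shift[of "flat_exp n" _ 0 x] flat_exp_has_derivative[of n x]
      by (simp add: add.commute)
    show "Ck_on k UNIV (\<lambda>x. flat_exp (n + 2) x + (- real n) * flat_exp (n + 1) x)"
      by (intro Ck_on_add Ck_on_mult Ck_on_const Suc)
  qed simp
qed

lemma bump_function_exists:
  fixes p :: "'n::euclidean_space"
  assumes "r > 0"
  obtains \<beta> where "smooth_on UNIV \<beta>" "\<beta> p = 1" "\<And>x. x \<notin> cball p r \<Longrightarrow> \<beta> x = 0"
proof -
  \<comment> \<open>A polynomial in the coordinates, so that the closure rules apply; it is positive
    exactly on the open ball of radius \<open>r\<close> about \<open>p\<close>.\<close>
  define q where "q x = r\<^sup>2 + (-1) * (\<Sum>b\<in>Basis. (x \<bullet> b + (- (p \<bullet> b))) * (x \<bullet> b + (- (p \<bullet> b))))" for x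
  have q: "q x = r\<^sup>2 - (dist p x)\<^sup>2" for x
    unfolding q_def dist_norm power2_norm_eq_inner euclidean_inner[of "p - x" "p - x"]
    by (simp add: inner_diff_left algebra_simps)
  \<comment> \<open>The constant factor cancels \<open>flat_exp 0 (r\<^sup>2)\<close> and so
    normalises the value at \<open>p\<close> to 1.\<close>
  define \<beta> where "\<beta> x = exp (inverse (r\<^sup>2)) * flat_exp 0 (q x)" for x
  have "Ck_on k UNIV (\<lambda>x. q x \<bullet> i)" if "i \<in> Basis" for k and i :: real
  proof -
    have "Ck_on k UNIV q" unfolding q_def by (intro Ck_on_add Ck_on_mult Ck_on_sum Ck_on_const Ck_on_inner)
    with that show ?thesis by simp
  qed
  then have "Ck_on k UNIV \<beta>" for k
    unfolding \<beta>_def by (intro Ck_on_mult Ck_on_const Ck_on_compose[OF Ck_on_flat_exp]) auto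
  then have "smooth_on UNIV \<beta>" by (simp add: smooth_on_iff_Ck_on)
  moreover have "\<beta> p = 1"
    using assms by (simp add: \<beta>_def q flat_exp_def exp_minus)
  moreover have "\<beta> x = 0" if "x \<notin> cball p r" for x
    using that assms power_strict_mono[of r "dist p x" 2] by (simp add: \<beta>_def q flat_exp_def)
  ultimately show ?thesis using that by blast
qed

section \<open>Integrals along rays and Hadamard's expansion\<close>

lemma ray_in_ball:
  fixes p :: "'n::real_normed_vector"
  assumes "x \<in> ball p R" "0 \<le> s" "s \<le> 1"
  shows "p + s *\<^sub>R (x - p) \<in> ball p R"
proof -
  have "s * norm (x - p) \<le> 1 * norm (x - p)"
    using assms by (intro mult_right_mono) auto
  then show ?thesis using assms by (simp add: dist_norm norm_minus_commute)
qed

lemma continuous_on_ray_integrand: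
  fixes p :: "'n::euclidean_space"
  assumes "continuous_on (ball p R) F" "continuous_on S g" "g ` S \<subseteq> ball p R"
  shows "continuous_on (S \<times> cbox 0 1) (\<lambda>(t, s). s ^ m * F (p + s *\<^sub>R (g t - p)))"
proof -
  have "continuous_on (S \<times> cbox 0 1) (\<lambda>z. F (p + snd z *\<^sub>R (g (fst z) - p)))"
  proof (rule continuous_on_compose2[OF assms(1)])
    show "continuous_on (S \<times> cbox 0 1) (\<lambda>z. p + snd z *\<^sub>R (g (fst z) - p))"
      by (intro continuous_intros continuous_on_compose2[OF assms(2)]) auto
    show "(\<lambda>z. p + snd z *\<^sub>R (g (fst z) - p)) ` (S \<times> cbox 0 1) \<subseteq> ball p R"
      using assms(3) by (auto intro!: ray_in_ball)
  qed
  then show ?thesis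
    unfolding split_beta by (intro continuous_intros)
qed

text \<open>Differentiating under the integral raises the exponent of \<open>s\<close>, whence the general \<open>m\<close>.\<close>
lemma Ck_on_ray_integral:
  fixes p :: "'n::euclidean_space"
  assumes "Ck_on k (ball p R) F"
  shows "Ck_on k (ball p R) (\<lambda>x. integral (cbox 0 1) (\<lambda>s. s ^ m * F (p + s *\<^sub>R (x - p))))"
  using assms
proof (induction k arbitrary: F m)
  case 0
  have "continuous_on (ball p R \<times> cbox 0 1) (\<lambda>(x, s). s ^ m * F (p + s *\<^sub>R (x - p)))"
    using continuous_on_ray_integrand[of p R F "ball p R" "\<lambda>x. x" m] 0 by (simp add: continuous_on_id)
  then show ?case unfolding Ck_on.simps by (rule integral_continuous_on_param)
next
  case (Suc k)
  from Suc.prems obtain D where D: "\<And>b. b \<in> Basis \<Longrightarrow> Ck_on k (ball p R) (D b)"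
      "\<And>b x. b \<in> Basis \<Longrightarrow> x \<in> ball p R \<Longrightarrow> ((\<lambda>t. F (x + t *\<^sub>R b)) has_real_derivative D b x) (at 0)"
    by (rule Ck_on_Suc_partialsE) blast
  show ?case
  proof (rule Ck_on_SucI)
    fix b x :: 'n assume b: "b \<in> Basis" and x: "x \<in> ball p R"
    \<comment> \<open>An open interval about 0, short enough that moving \<open>x\<close> along the
      unit vector \<open>b\<close> stays inside the ball.\<close>
    define T where "T = ball (0::real) (R - dist p x)"
    have T: "x + t *\<^sub>R b \<in> ball p R" if "t \<in> T" for t
    proof -
      have "dist p (x + t *\<^sub>R b) \<le> dist p x + norm (t *\<^sub>R b)"
        using dist_triangle[of p "x + t *\<^sub>R b" x] by (simp add: dist_norm)
      then show ?thesis using that b by (simp add: T_def)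
    qed
    have cont: "continuous_on (T \<times> cbox 0 1) (\<lambda>(t, s). s ^ j * G (p + s *\<^sub>R ((x + t *\<^sub>R b) - p)))"
      if "continuous_on (ball p R) G" for j G
      by (rule continuous_on_ray_integrand[OF that]) (use T in \<open>auto intro!: continuous_intros\<close>)
    have "((\<lambda>t. integral (cbox 0 1) (\<lambda>s. s ^ m * F (p + s *\<^sub>R ((x + t *\<^sub>R b) - p)))) has_real_derivative
        integral (cbox 0 1) (\<lambda>s. s ^ Suc m * D b (p + s *\<^sub>R ((x + 0 *\<^sub>R b) - p)))) (at 0 within T)"
    proof (rule leibniz_rule_field_derivative)
      fix t s assume t: "t \<in> T" and s: "s \<in> cbox 0 (1::real)"
      \<comment> \<open>A shift of \<open>x\<close> by \<open>t'\<close> moves the point on the ray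
        by only \<open>s * t'\<close>; this is the source of the extra factor
        \<open>s\<close>.\<close>
      have eq: "p + s *\<^sub>R ((x + t' *\<^sub>R b) - p) = (p + s *\<^sub>R (x - p)) + (s * t') *\<^sub>R b" for t'
        by (simp add: algebra_simps)
      have "((\<lambda>u. F ((p + s *\<^sub>R (x - p)) + u *\<^sub>R b)) has_real_derivative
           D b (p + s *\<^sub>R ((x + t *\<^sub>R b) - p))) (at (s * t))"
        unfolding eq
      proof (rule has_real_derivative_line_shift, rule D(2)[OF b])
        show "p + s *\<^sub>R (x - p) + (s * t) *\<^sub>R b \<in> ball p R"
          using ray_in_ball[OF T[OF t], of s] s unfolding eq by simp
      qed
      moreover have "((\<lambda>t. s * t) has_real_derivative s) (at t)"
        by (auto intro!: derivative_eq_intros)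
      ultimately have "((\<lambda>t. F (p + s *\<^sub>R ((x + t *\<^sub>R b) - p))) has_real_derivative
           D b (p + s *\<^sub>R ((x + t *\<^sub>R b) - p)) * s) (at t)"
        unfolding eq by (rule DERIV_chain2[where g = "\<lambda>t. s * t"])
      from DERIV_cmult[OF this, of "s ^ m"]
      show "((\<lambda>t. s ^ m * F (p + s *\<^sub>R ((x + t *\<^sub>R b) - p))) has_real_derivative
           s ^ Suc m * D b (p + s *\<^sub>R ((x + t *\<^sub>R b) - p))) (at t within T)"
        by (simp add: mult_ac has_field_derivative_at_within)
    next
      fix t assume "t \<in> T"
      then have "continuous_on (cbox 0 1) (\<lambda>s. (\<lambda>(t, s). s ^ m * F (p + s *\<^sub>R ((x + t *\<^sub>R b) - p))) (t, s))"
        by (intro continuous_on_compose2[OF cont[OF Ck_on_imp_continuous_on[OF Suc.prems]]])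
          (auto intro!: continuous_intros)
      then show "(\<lambda>s. s ^ m * F (p + s *\<^sub>R ((x + t *\<^sub>R b) - p))) integrable_on cbox 0 1"
        using integrable_continuous by (simp only: prod.case)
    next
      show "continuous_on (T \<times> cbox 0 1) (\<lambda>(t, s). s ^ Suc m * D b (p + s *\<^sub>R ((x + t *\<^sub>R b) - p)))"
        by (rule cont[OF Ck_on_imp_continuous_on[OF D(1)[OF b]]])
    qed (use x in \<open>auto simp: T_def\<close>)
    then show "((\<lambda>t. integral (cbox 0 1) (\<lambda>s. s ^ m * F (p + s *\<^sub>R ((x + t *\<^sub>R b) - p)))) has_real_derivative
        integral (cbox 0 1) (\<lambda>s. s ^ Suc m * D b (p + s *\<^sub>R (x - p)))) (at 0)"
      using x at_within_open[of 0 T] by (simp add: T_def)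
  next
    fix b :: 'n assume b: "b \<in> Basis"
    show "Ck_on k (ball p R) (\<lambda>x. integral (cbox 0 1) (\<lambda>s. s ^ Suc m * D b (p + s *\<^sub>R (x - p))))"
      by (rule Suc.IH[OF D(1)[OF b]])
  qed simp
qed

text \<open>Each \<open>h b\<close> is the average of the partial derivative over the segment from
  \<open>p\<close> to \<open>x\<close>. The expansion is the fundamental theorem of calculus along
  that segment, and smoothness of \<open>h b\<close> is differentiation under the integral.\<close>

lemma hadamard_lemma:
  fixes p :: "'n::euclidean_space"
  assumes f: "smooth_on (ball p R) f"
  obtains h where "\<And>b. b \<in> Basis \<Longrightarrow> smooth_on (ball p R) (h b)"
    "\<And>x. x \<in> ball p R \<Longrightarrow> f x = f p + (\<Sum>b\<in>Basis. ((x - p) \<bullet> b) * h b x)"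
    "\<And>b. b \<in> Basis \<Longrightarrow> h b p = dir_deriv b f p"
proof -
  \<comment> \<open>The trivial factor \<open>s ^ 0\<close> gives the integrand the shape of
    \<open>Ck_on_ray_integral\<close> at \<open>m = 0\<close>.\<close>
  define h where "h b x = integral (cbox 0 1) (\<lambda>s. s ^ 0 * dir_deriv b f (p + s *\<^sub>R (x - p)))" for b x
  have 1: "smooth_on (ball p R) (h b)" if "b \<in> Basis" for b
    using smooth_on_dir_deriv[OF f that] unfolding smooth_on_iff_Ck_on[OF open_ball] h_def
    by (blast intro: Ck_on_ray_integral)
  have 2: "h b p = dir_deriv b f p" for b
    by (simp add: h_def)
  have 3: "f x = f p + (\<Sum>b\<in>Basis. ((x - p) \<bullet> b) * h b x)" if x: "x \<in> ball p R" for x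
  proof -
    have cont: "continuous_on (cbox 0 1) (\<lambda>s. s ^ 0 * dir_deriv b f (p + s *\<^sub>R (x - p)))" if "b \<in> Basis" for b
    proof -
      have "continuous_on (ball p R) (dir_deriv b f)"
        using smooth_on_dir_deriv[OF f that] smooth_on_iff_Ck_on[OF open_ball] Ck_on_imp_continuous_on by blast
      then have "continuous_on (cbox 0 1) (\<lambda>s. dir_deriv b f (p + s *\<^sub>R (x - p)))"
        by (rule continuous_on_compose2) (use ray_in_ball[OF x] in \<open>auto intro!: continuous_intros\<close>)
      then show ?thesis by simp
    qed
    have "((\<lambda>s. \<Sum>b\<in>Basis. ((x - p) \<bullet> b) * (s ^ 0 * dir_deriv b f (p + s *\<^sub>R (x - p)))) has_integral
        f (p + 1 *\<^sub>R (x - p)) - f (p + 0 *\<^sub>R (x - p))) {0..1}"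
    proof (rule fundamental_theorem_of_calculus)
      fix s :: real assume s: "s \<in> {0..1}"
      have "((\<lambda>t. f ((p + s *\<^sub>R (x - p)) + t *\<^sub>R (x - p))) has_real_derivative
          (\<Sum>b\<in>Basis. ((x - p) \<bullet> b) * dir_deriv b f (p + s *\<^sub>R (x - p)))) (at 0)"
        by (rule has_derivative_imp_partial[OF smooth_on_has_derivative[OF f open_ball]])
          (use ray_in_ball[OF x] s in auto)
      from has_real_derivative_line_shift[OF this]
      show "((\<lambda>s. f (p + s *\<^sub>R (x - p))) has_vector_derivative
          (\<Sum>b\<in>Basis. ((x - p) \<bullet> b) * (s ^ 0 * dir_deriv b f (p + s *\<^sub>R (x - p))))) (at s within {0..1})"
        by (simp add: has_real_derivative_iff_has_vector_derivative has_vector_derivative_at_within)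
    qed simp
    moreover have "((\<lambda>s. \<Sum>b\<in>Basis. ((x - p) \<bullet> b) * (s ^ 0 * dir_deriv b f (p + s *\<^sub>R (x - p)))) has_integral
        (\<Sum>b\<in>Basis. ((x - p) \<bullet> b) * h b x)) {0..1}"
      unfolding h_def
      by (intro has_integral_sum has_integral_mult_right)
        (use integrable_continuous[OF cont] in \<open>auto simp: integrable_integral\<close>)
    ultimately have "f (p + 1 *\<^sub>R (x - p)) - f (p + 0 *\<^sub>R (x - p)) = (\<Sum>b\<in>Basis. ((x - p) \<bullet> b) * h b x)"
      by (rule has_integral_unique)
    then show ?thesis by simp
  qed
  show ?thesis by (rule that[OF 1 3 2])
qed

subsection \<open>Extension of tangent vectors\<close>

lemma smooth_on_subset: "smooth_on U f \<Longrightarrow> V \<subseteq> U \<Longrightarrow> smooth_on V f"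
  unfolding smooth_on_def by (meson continuous_on_subset subsetD)

lemma smooth_on_const: "open U \<Longrightarrow> smooth_on U (\<lambda>x. c)"
  by (simp add: smooth_on_iff_Ck_on Ck_on_const)

lemma smooth_on_add: "open U \<Longrightarrow> smooth_on U f \<Longrightarrow> smooth_on U g \<Longrightarrow> smooth_on U (\<lambda>x. f x + g x)"
  by (simp add: smooth_on_iff_Ck_on Ck_on_add)

lemma smooth_on_mult: "open U \<Longrightarrow> smooth_on U f \<Longrightarrow> smooth_on U g \<Longrightarrow> smooth_on U (\<lambda>x. f x * g x)"
  by (simp add: smooth_on_iff_Ck_on Ck_on_mult)

lemma smooth_on_sum: "open U \<Longrightarrow> (\<And>i. i \<in> I \<Longrightarrow> smooth_on U (f i)) \<Longrightarrow> smooth_on U (\<lambda>x. \<Sum>i\<in>I. f i x)"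
  by (simp add: smooth_on_iff_Ck_on Ck_on_sum)

lemma smooth_on_coordinate:
  assumes "open U"
  shows "smooth_on U (\<lambda>x. (x - p) \<bullet> b)"
proof -
  have "Ck_on k U (\<lambda>x. x \<bullet> b + (- (p \<bullet> b)))" for k
    by (intro Ck_on_add Ck_on_inner Ck_on_const)
  then show ?thesis using assms by (simp add: smooth_on_iff_Ck_on inner_diff_left)
qed

lemma dir_deriv_add:
  assumes "smooth_on U f" "smooth_on U g" "b \<in> Basis" "x \<in> U"
  shows "dir_deriv b (\<lambda>x. f x + g x) x = dir_deriv b f x + dir_deriv b g x"
  unfolding dir_deriv_def[of b "\<lambda>x. f x + g x"]
  by (intro DERIV_imp_deriv DERIV_add smooth_on_has_partial[OF assms(1)] smooth_on_has_partial[OF assms(2)] assms)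

lemma dir_deriv_cmult:
  assumes "smooth_on U f" "b \<in> Basis" "x \<in> U"
  shows "dir_deriv b (\<lambda>x. c * f x) x = c * dir_deriv b f x"
  unfolding dir_deriv_def[of b "\<lambda>x. c * f x"]
  by (intro DERIV_imp_deriv DERIV_cmult smooth_on_has_partial[OF assms(1)] assms)

lemma dir_deriv_mult:
  assumes "smooth_on U f" "smooth_on U g" "b \<in> Basis" "x \<in> U"
  shows "dir_deriv b (\<lambda>x. f x * g x) x = f x * dir_deriv b g x + g x * dir_deriv b f x"
  unfolding dir_deriv_def[of b "\<lambda>x. f x * g x"]
  using DERIV_mult[OF smooth_on_has_partial[OF assms(1,3,4)] smooth_on_has_partial[OF assms(2,3,4)]]
  by (intro DERIV_imp_deriv) (simp add: algebra_simps)

section \<open>Charts and global smooth functions\<close>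

lemma smooth_atlas_chart:
  assumes "smooth_atlas A" "(U, \<phi>) \<in> A"
  shows "open U" "open (\<phi> ` U)" "inj_on \<phi> U" "homeomorphism U (\<phi> ` U) \<phi> (inv_into U \<phi>)"
  using assms unfolding smooth_atlas_def by blast+

lemma open_chart_image:
  assumes "smooth_atlas A" "(U, \<phi>) \<in> A" "open S" "S \<subseteq> U"
  shows "open (\<phi> ` S)"
proof -
  have "openin (top_of_set U) S" using assms(3,4) by (auto simp: openin_open)
  from homeomorphism_imp_open_map[OF smooth_atlas_chart(4)[OF assms(1,2)] this]
  show ?thesis using smooth_atlas_chart(2)[OF assms(1,2)] openin_open_trans by blast
qed

lemma smooth_funD: "smooth_fun A f \<Longrightarrow> (U, \<phi>) \<in> A \<Longrightarrow> smooth_on (\<phi> ` U) (\<lambda>x. f (inv_into U \<phi> x))"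
  by (auto simp: smooth_fun_def o_def)

lemma smooth_funI:
  "(\<And>U \<phi>. (U, \<phi>) \<in> A \<Longrightarrow> smooth_on (\<phi> ` U) (\<lambda>x. f (inv_into U \<phi> x))) \<Longrightarrow> smooth_fun A f"
  by (auto simp: smooth_fun_def o_def)

lemma smooth_fun_const: "smooth_atlas A \<Longrightarrow> smooth_fun A (\<lambda>x. c)"
  by (rule smooth_funI) (blast intro: smooth_on_const smooth_atlas_chart(2))

lemma smooth_fun_add:
  "smooth_atlas A \<Longrightarrow> smooth_fun A f \<Longrightarrow> smooth_fun A g \<Longrightarrow> smooth_fun A (\<lambda>x. f x + g x)"
  by (rule smooth_funI, rule smooth_on_add) (erule (1) smooth_atlas_chart(2) smooth_funD)+

lemma smooth_fun_mult:
  "smooth_atlas A \<Longrightarrow> smooth_fun A f \<Longrightarrow> smooth_fun A g \<Longrightarrow> smooth_fun A (\<lambda>x. f x * g x)"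
  by (rule smooth_funI, rule smooth_on_mult) (erule (1) smooth_atlas_chart(2) smooth_funD)+

lemma smooth_fun_cmult: "smooth_atlas A \<Longrightarrow> smooth_fun A f \<Longrightarrow> smooth_fun A (\<lambda>x. c * f x)"
  by (intro smooth_fun_mult smooth_fun_const)

lemma smooth_fun_sum:
  "smooth_atlas A \<Longrightarrow> (\<And>i. i \<in> I \<Longrightarrow> smooth_fun A (f i)) \<Longrightarrow> smooth_fun A (\<lambda>x. \<Sum>i\<in>I. f i x)"
  by (induction I rule: infinite_finite_induct) (simp_all add: smooth_fun_const smooth_fun_add)

text \<open>Smoothness is checked near each point of another chart. Where \<open>F\<close> is
  available, the function is \<open>F\<close> composed with a transition map; elsewhere the point
  lies off the preimage \<open>L\<close> of \<open>K\<close>, which is closed, so the function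
  vanishes on a neighbourhood.\<close>

lemma smooth_fun_extend_by_zero:
  fixes A :: "('a::t2_space set \<times> ('a \<Rightarrow> 'n::euclidean_space)) set"
  assumes A: "smooth_atlas A" "(U, \<phi>) \<in> A" and W: "open W" "W \<subseteq> \<phi> ` U"
    and K: "compact K" "K \<subseteq> W" and F: "smooth_on W F" "\<And>x. x \<notin> K \<Longrightarrow> F x = 0"
  shows "smooth_fun A (\<lambda>q. if q \<in> U then F (\<phi> q) else 0)"
proof (rule smooth_funI)
  fix V \<psi> assume V: "(V, \<psi>) \<in> A"
  define G where "G x = (if inv_into V \<psi> x \<in> U then F (\<phi> (inv_into V \<psi> x)) else 0)" for x
  define L where "L = inv_into U \<phi> ` K"
  note cU = smooth_atlas_chart[OF A] and cV = smooth_atlas_chart[OF A(1) V]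
  have inv: "inv_into V \<psi> (\<psi> q) = q" if "q \<in> V" for q using cV(3) that by simp
  have L: "q \<in> L \<longleftrightarrow> q \<in> U \<and> \<phi> q \<in> K" for q
  proof
    assume "q \<in> L"
    then obtain y where "y \<in> K" "q = inv_into U \<phi> y" by (auto simp: L_def)
    moreover from this have "y \<in> \<phi> ` U" using K W by blast
    ultimately show "q \<in> U \<and> \<phi> q \<in> K" by (simp add: f_inv_into_f inv_into_into)
  next
    assume "q \<in> U \<and> \<phi> q \<in> K"
    then show "q \<in> L" unfolding L_def using cU(3) by (metis imageI inv_into_f_f)
  qed
  have "continuous_on K (inv_into U \<phi>)"
    using cU(4) K W by (meson continuous_on_subset homeomorphism_def order_trans)
  \<comment> \<open>A compact set is closed because the manifold is Hausdorff; compactness comes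
    from the continuous inverse chart.\<close>
  then have "closed L"
    unfolding L_def using K(1) by (intro compact_imp_closed compact_continuous_image)
  have "Ck_on k (\<psi> ` V) G" for k
  proof (rule Ck_on_locally[OF _ cV(2)])
    fix x assume "x \<in> \<psi> ` V"
    then obtain q where q: "q \<in> V" "x = \<psi> q" by auto
    show "\<exists>N. open N \<and> x \<in> N \<and> Ck_on k N G"
    proof (cases "q \<in> U \<and> \<phi> q \<in> W")
      case True
      define S where "S = V \<inter> (U \<inter> \<phi> -` W)"
      have "open (U \<inter> \<phi> -` W)"
        using continuous_open_preimage[of U \<phi> W] cU W(1) by (simp add: homeomorphism_def)
      then have S: "open (\<psi> ` S)"
        using cV(1) by (intro open_chart_image[OF A(1) V]) (auto simp: S_def)
      have "smooth_map_on (\<psi> ` (V \<inter> U)) (\<phi> \<circ> inv_into V \<psi>)"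
        using A V unfolding smooth_atlas_def by blast
      then have "smooth_on (\<psi> ` S) (\<lambda>x. \<phi> (inv_into V \<psi> x) \<bullet> i)" if "i \<in> Basis" for i
        using that smooth_on_subset[of "\<psi> ` (V \<inter> U)" _ "\<psi> ` S"]
        by (auto simp: smooth_map_on_def S_def)
      then have 1: "Ck_on k (\<psi> ` S) (\<lambda>x. \<phi> (inv_into V \<psi> x) \<bullet> i)" if "i \<in> Basis" for i
        using that smooth_on_iff_Ck_on[OF S] by blast
      have 2: "(\<lambda>x. \<phi> (inv_into V \<psi> x)) ` (\<psi> ` S) \<subseteq> W"
        by (auto simp: S_def inv)
      have "Ck_on k W F" using F(1) smooth_on_iff_Ck_on[OF W(1)] by blast
      from Ck_on_compose[OF this 1 2] have "Ck_on k (\<psi> ` S) (\<lambda>x. F (\<phi> (inv_into V \<psi> x)))" .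
      then have "Ck_on k (\<psi> ` S) G"
        by (subst Ck_on_cong[OF S]) (auto simp: S_def inv G_def)
      then show ?thesis using S q True by (intro exI[of _ "\<psi> ` S"]) (auto simp: S_def)
    next
      case False
      \<comment> \<open>Since \<open>K\<close> lies in \<open>W\<close>, the point \<open>q\<close>
        is outside \<open>L\<close>, and removing the closed set \<open>L\<close> leaves a
        neighbourhood on which \<open>G\<close> is zero.\<close>
      have N: "open (\<psi> ` (V - L))"
        using \<open>closed L\<close> cV(1) by (intro open_chart_image[OF A(1) V]) auto
      have "G y = 0" if "y \<in> \<psi> ` (V - L)" for y
        using that L F(2) by (auto simp: G_def inv)
      then have "Ck_on k (\<psi> ` (V - L)) G"
        using Ck_on_const[of k "\<psi> ` (V - L)" 0] by (subst Ck_on_cong[OF N]) auto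
      moreover have "x \<in> \<psi> ` (V - L)"
        using q False L K(2) by blast
      ultimately show ?thesis using N by blast
    qed
  qed
  then show "smooth_on (\<psi> ` V) (\<lambda>x. if inv_into V \<psi> x \<in> U then F (\<phi> (inv_into V \<psi> x)) else 0)"
    unfolding G_def[symmetric] by (simp add: smooth_on_iff_Ck_on cV(2))
qed

section \<open>Derivations and their extension to vector fields\<close>

lemma tangent_space_iff:
  "v \<in> tangent_space A p \<longleftrightarrow>
     (\<forall>f. \<not> smooth_fun A f \<longrightarrow> v f = 0) \<and>
     (\<forall>f h. smooth_fun A f \<and> smooth_fun A h \<longrightarrow> v (\<lambda>x. f x + h x) = v f + v h) \<and>
     (\<forall>f h. smooth_fun A f \<and> smooth_fun A h \<longrightarrow> v (\<lambda>x. f x * h x) = f p * v h + h p * v f) \<and>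
     (\<forall>c f. smooth_fun A f \<longrightarrow> v (\<lambda>x. c * f x) = c * v f)"
  unfolding tangent_space_def func_plus scaleR_fun_def real_scaleR_def by blast

lemma tangent_spaceD:
  assumes "v \<in> tangent_space A p"
  shows "\<not> smooth_fun A f \<Longrightarrow> v f = 0"
    "smooth_fun A f \<Longrightarrow> smooth_fun A h \<Longrightarrow> v (\<lambda>x. f x + h x) = v f + v h"
    "smooth_fun A f \<Longrightarrow> smooth_fun A h \<Longrightarrow> v (\<lambda>x. f x * h x) = f p * v h + h p * v f"
    "smooth_fun A f \<Longrightarrow> v (\<lambda>x. c * f x) = c * v f"
  using assms unfolding tangent_space_iff by blast+

lemma tangent_vector_sum:
  assumes "smooth_atlas A" "v \<in> tangent_space A p" "\<And>i. i \<in> I \<Longrightarrow> smooth_fun A (f i)"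
  shows "v (\<lambda>x. \<Sum>i\<in>I. f i x) = (\<Sum>i\<in>I. v (f i))"
proof -
  have "v (\<lambda>x. 0) = 0"
    using tangent_spaceD(4)[OF assms(2) smooth_fun_const[OF assms(1)], of 0 0] by simp
  then show ?thesis using assms(3)
    by (induction I rule: infinite_finite_induct)
      (simp_all add: tangent_spaceD(2)[OF assms(2)] smooth_fun_sum assms(1))
qed

text \<open>The field is a bump function times a coordinate field with constant coefficients, the
  components of \<open>v\<close> in the chart. Hadamard's lemma shows that these components
  determine \<open>v\<close>, although \<open>v\<close> acts only on global functions.\<close>

lemma tangent_vector_extends:
  fixes A :: "('a::t2_space set \<times> ('a \<Rightarrow> 'n::euclidean_space)) set"
  assumes A: "smooth_atlas A" and v: "v \<in> tangent_space A p"
  obtains X where "vector_field A X" "X p = v"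
proof -
  obtain U \<phi> where U: "(U, \<phi>) \<in> A" "p \<in> U"
    using A unfolding smooth_atlas_def by blast
  note chart = smooth_atlas_chart[OF A U(1)]
  have inv: "inv_into U \<phi> (\<phi> q) = q" if "q \<in> U" for q using chart(3) that by simp
  obtain R where R: "R > 0" "ball (\<phi> p) R \<subseteq> \<phi> ` U"
    using chart(2) U(2) openE by (metis image_eqI)
  obtain \<beta> where \<beta>: "smooth_on UNIV \<beta>" "\<beta> (\<phi> p) = 1" "\<And>x. x \<notin> cball (\<phi> p) (R / 2) \<Longrightarrow> \<beta> x = 0"
    using bump_function_exists[of "R / 2" "\<phi> p"] R(1) by auto
  \<comment> \<open>Turns a function on the coordinate ball into a global one; the bump vanishes
    outside the half-radius ball, so extension by zero is smooth.\<close>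
  define lift where "lift F q = (if q \<in> U then \<beta> (\<phi> q) * F (\<phi> q) else 0)" for F q
  have lift: "smooth_fun A (lift F)" if "smooth_on (ball (\<phi> p) R) F" for F
    unfolding lift_def
  proof (rule smooth_fun_extend_by_zero[OF A U(1) open_ball R(2) compact_cball[of "\<phi> p" "R / 2"]])
    show "smooth_on (ball (\<phi> p) R) (\<lambda>x. \<beta> x * F x)"
      by (intro smooth_on_mult smooth_on_subset[OF \<beta>(1)] that) auto
  qed (use R(1) \<beta>(3) in auto)
  \<comment> \<open>The components of \<open>v\<close>, obtained by applying it to the cut-off,
    centred coordinate functions.\<close>
  define c where "c b = v (lift (\<lambda>x. (x - \<phi> p) \<bullet> b))" for b
  \<comment> \<open>The default 0 on non-smooth functions is the normalisation required by
    \<open>tangent_space\<close>.\<close>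
  define X where "X q f = (if smooth_fun A f then
      lift (\<lambda>x. \<Sum>b\<in>Basis. c b * dir_deriv b (\<lambda>x. f (inv_into U \<phi> x)) x) q else 0)" for q f
  have X_nonsmooth: "X q f = 0" if "\<not> smooth_fun A f" for q f
    using that by (simp add: X_def)
  have X_U: "X q f = \<beta> (\<phi> q) * (\<Sum>b\<in>Basis. c b * dir_deriv b (\<lambda>x. f (inv_into U \<phi> x)) (\<phi> q))"
    if "smooth_fun A f" "q \<in> U" for q f
    using that by (simp add: X_def lift_def)
  have X_not_U: "X q f = 0" if "q \<notin> U" for q f
    using that by (simp add: X_def lift_def)
  have tangent: "X q \<in> tangent_space A q" for q
  proof (cases "q \<in> U")
    case False
    then show ?thesis by (simp add: tangent_space_iff X_not_U)
  next
    case True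
    then have q: "\<phi> q \<in> \<phi> ` U" by blast
    show ?thesis
      unfolding tangent_space_iff
    proof (intro conjI allI impI; (elim conjE)?)
      fix f h assume f: "smooth_fun A f" and h: "smooth_fun A h"
      note fh = smooth_funD[OF f U(1)] smooth_funD[OF h U(1)]
      show "X q (\<lambda>x. f x + h x) = X q f + X q h"
        using f h True by (simp add: X_U smooth_fun_add[OF A] dir_deriv_add[OF fh _ q] sum.distrib distrib_left)
      show "X q (\<lambda>x. f x * h x) = f q * X q h + h q * X q f"
        using f h True
        by (simp add: X_U smooth_fun_mult[OF A] dir_deriv_mult[OF fh _ q] inv sum.distrib sum_distrib_left algebra_simps)
    next
      fix k f assume f: "smooth_fun A f"
      show "X q (\<lambda>x. k * f x) = k * X q f"
        using f True
        by (simp add: X_U smooth_fun_cmult[OF A] dir_deriv_cmult[OF smooth_funD[OF f U(1)] _ q] sum_distrib_left mult_ac)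
    qed (rule X_nonsmooth)
  qed
  have "smooth_fun A (\<lambda>q. X q f)" if f: "smooth_fun A f" for f
  proof -
    have "smooth_on (ball (\<phi> p) R) (\<lambda>x. \<Sum>b\<in>Basis. c b * dir_deriv b (\<lambda>x. f (inv_into U \<phi> x)) x)"
      using smooth_on_dir_deriv smooth_on_subset[OF smooth_funD[OF f U(1)] R(2)]
      by (intro smooth_on_sum smooth_on_mult smooth_on_const open_ball) blast
    from lift[OF this] show ?thesis using f by (simp add: X_def)
  qed
  with tangent have "vector_field A X" by (simp add: vector_field_def)
  moreover have "X p = v"
  proof
    fix f
    show "X p f = v f"
    proof (cases "smooth_fun A f")
      case False
      then show ?thesis using X_nonsmooth tangent_spaceD(1)[OF v] by simp
    next
      case f: True
      obtain h where h: "\<And>b. b \<in> Basis \<Longrightarrow> smooth_on (ball (\<phi> p) R) (h b)"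
        "\<And>x. x \<in> ball (\<phi> p) R \<Longrightarrow>
          f (inv_into U \<phi> x) = f (inv_into U \<phi> (\<phi> p)) + (\<Sum>b\<in>Basis. ((x - \<phi> p) \<bullet> b) * h b x)"
        "\<And>b. b \<in> Basis \<Longrightarrow> h b (\<phi> p) = dir_deriv b (\<lambda>x. f (inv_into U \<phi> x)) (\<phi> p)"
        using hadamard_lemma[OF smooth_on_subset[OF smooth_funD[OF f U(1)] R(2)]] by blast
      define B where "B = lift (\<lambda>x. 1)"
      define x where "x b = lift (\<lambda>x. (x - \<phi> p) \<bullet> b)" for b
      define H where "H b = lift (h b)" for b
      have smooth: "smooth_fun A B" "\<And>b. smooth_fun A (x b)" "\<And>b. b \<in> Basis \<Longrightarrow> smooth_fun A (H b)"
        unfolding B_def x_def H_def by (intro lift smooth_on_const smooth_on_coordinate h(1) open_ball; assumption)+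
      have at_p: "B p = 1" "\<And>b. x b p = 0" "\<And>b. H b p = h b (\<phi> p)"
        using U(2) \<beta>(2) by (simp_all add: B_def x_def H_def lift_def)
      \<comment> \<open>Hadamard's expansion times the square of the bump function: every factor is now a global
        smooth function, to which the derivation \<open>v\<close> applies.\<close>
      have eq: "(\<lambda>q. (B q * B q) * f q) = (\<lambda>q. f p * (B q * B q) + (\<Sum>b\<in>Basis. x b q * H b q))"
      proof
        fix q
        consider "q \<notin> U" | "q \<in> U" "\<phi> q \<notin> ball (\<phi> p) R" | "q \<in> U" "\<phi> q \<in> ball (\<phi> p) R" by blast
        then show "(B q * B q) * f q = f p * (B q * B q) + (\<Sum>b\<in>Basis. x b q * H b q)"
        proof cases
          \<comment> \<open>The support of the bump lies in the closed ball of radius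
            \<open>R / 2\<close>, so both sides vanish here.\<close>
          case 2
          then have "\<beta> (\<phi> q) = 0" using R(1) by (intro \<beta>(3)) auto
          then show ?thesis by (simp add: B_def x_def H_def lift_def)
        next
          case 3
          from h(2)[OF 3(2)] show ?thesis
            using 3(1) by (simp add: B_def x_def H_def lift_def inv U(2) distrib_left sum_distrib_left mult_ac)
        qed (simp add: B_def x_def H_def lift_def)
      qed
      have BB: "smooth_fun A (\<lambda>q. B q * B q)" by (intro smooth_fun_mult A smooth)
      have xH: "smooth_fun A (\<lambda>q. x b q * H b q)" if "b \<in> Basis" for b
        by (intro smooth_fun_mult A smooth that)
      \<comment> \<open>Leibniz at \<open>p\<close>, where \<open>B\<close> equals 1. The term
        \<open>f p * v (\<lambda>q. B q * B q)\<close> recurs on the other side of the chain and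
        cancels.\<close>
      have "f p * v (\<lambda>q. B q * B q) + v f = v (\<lambda>q. (B q * B q) * f q)"
        using tangent_spaceD(3)[OF v BB f] at_p by simp
      also have "\<dots> = f p * v (\<lambda>q. B q * B q) + (\<Sum>b\<in>Basis. v (\<lambda>q. x b q * H b q))"
        unfolding eq
        by (simp add: tangent_spaceD(2)[OF v] tangent_spaceD(4)[OF v] BB xH smooth_fun_cmult[OF A]
            smooth_fun_sum[OF A] tangent_vector_sum[OF A v])
      also have "(\<Sum>b\<in>Basis. v (\<lambda>q. x b q * H b q)) = (\<Sum>b\<in>Basis. c b * dir_deriv b (\<lambda>x. f (inv_into U \<phi> x)) (\<phi> p))"
        \<comment> \<open>As \<open>x b\<close> vanishes at \<open>p\<close>, Leibniz leaves only
          \<open>v (x b)\<close> times the value of \<open>H b\<close> at \<open>p\<close>, which is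
          the partial derivative of \<open>f\<close> in the chart.\<close>
        by (intro sum.cong refl)
          (simp add: tangent_spaceD(3)[OF v] smooth at_p h(3) c_def x_def[symmetric])
      finally show ?thesis using X_U[OF f U(2)] \<beta>(2) by simp
    qed
  qed
  ultimately show ?thesis by (rule that)
qed

subsection \<open>The Koszul form and the curvature\<close>

lemma tangent_space_diff: "u \<in> tangent_space A p \<Longrightarrow> w \<in> tangent_space A p \<Longrightarrow> u - w \<in> tangent_space A p"
  unfolding tangent_space_iff by (simp add: algebra_simps)

lemma vector_fieldD:
  assumes "vector_field A X"
  shows "X p \<in> tangent_space A p" "smooth_fun A f \<Longrightarrow> smooth_fun A (\<lambda>q. X q f)"
  using assms by (simp_all add: vector_field_def)

text \<open>In the commutator the mixed products of first derivatives cancel, so the Leibniz rule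
  survives.\<close>

lemma vector_field_lie:
  assumes A: "smooth_atlas A" and X: "vector_field A X" and Y: "vector_field A Y"
  shows "vector_field A (lie A X Y)"
  unfolding vector_field_def
proof (intro conjI allI impI)
  note sm = vector_fieldD(2)[OF X] vector_fieldD(2)[OF Y]
    smooth_fun_add[OF A] smooth_fun_mult[OF A] smooth_fun_cmult[OF A]
  note X' = tangent_spaceD[OF vector_fieldD(1)[OF X]] and Y' = tangent_spaceD[OF vector_fieldD(1)[OF Y]]
  show "lie A X Y p \<in> tangent_space A p" for p
    unfolding tangent_space_iff
    by (auto simp: lie_def sm X'(2-4) Y'(2-4) algebra_simps)
  fix f assume f: "smooth_fun A f"
  have "smooth_fun A (\<lambda>p. X p (\<lambda>q. Y q f) + (- 1) * Y p (\<lambda>q. X q f))"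
    by (intro sm f)
  then show "smooth_fun A (\<lambda>p. lie A X Y p f)" using f by (simp add: lie_def)
qed

lemma lie_antisym: "lie A Y X p = (-1) *\<^sub>R lie A X Y p"
  by (auto simp: lie_def scaleR_fun_def fun_eq_iff)

section \<open>Symmetry, bilinearity and metric compatibility of the Koszul form\<close>

context
  fixes A :: "('a::topological_space set \<times> ('a \<Rightarrow> 'n::euclidean_space)) set"
    and g :: "'a \<Rightarrow> 'a tvec \<Rightarrow> 'a tvec \<Rightarrow> real"
  assumes A: "smooth_atlas A" and g: "sym_bilinear_field A g"
begin

lemma metric_sym: "u \<in> tangent_space A p \<Longrightarrow> w \<in> tangent_space A p \<Longrightarrow> g p u w = g p w u"
  using g by (simp add: sym_bilinear_field_def)

lemma metric_lincomb:
  "u \<in> tangent_space A p \<Longrightarrow> v \<in> tangent_space A p \<Longrightarrow> w \<in> tangent_space A p \<Longrightarrow>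
     g p (a *\<^sub>R u + b *\<^sub>R v) w = a * g p u w + b * g p v w"
  using g by (simp add: sym_bilinear_field_def)

lemma metric_diff:
  assumes "u \<in> tangent_space A p" "v \<in> tangent_space A p" "w \<in> tangent_space A p"
  shows "g p (u - v) w = g p u w - g p v w"
  using metric_lincomb[OF assms, of 1 "-1"] by simp

lemma metric_lie_antisym:
  assumes "vector_field A X" "vector_field A Y" "u \<in> tangent_space A p"
  shows "g p u (lie A Y X p) = - g p u (lie A X Y p)"
proof -
  have L: "lie A X Y p \<in> tangent_space A p"
    using vector_fieldD(1) vector_field_lie[OF A assms(1,2)] by blast
  \<comment> \<open>The vanishing second summand fits the two-term linearity axiom of the
    metric.\<close>
  have "g p ((-1) *\<^sub>R lie A X Y p + 0 *\<^sub>R u) u = - g p (lie A X Y p) u"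
    using metric_lincomb[OF L assms(3,3), of "-1" 0] by simp
  then have "g p (lie A Y X p) u = - g p (lie A X Y p) u"
    by (simp add: lie_antisym[of A Y X])
  moreover have "lie A Y X p \<in> tangent_space A p"
    using vector_fieldD(1) vector_field_lie[OF A assms(2,1)] by blast
  ultimately show ?thesis using L assms(3) by (simp add: metric_sym)
qed

text \<open>Apart from the derivative of \<open>g(Y, Z)\<close> along \<open>X\<close>, all terms of
  the Koszul form taken together are antisymmetric under exchanging \<open>Y\<close> and
  \<open>Z\<close>, so they cancel in the sum and the factor 1/2 disappears.\<close>

lemma koszul_metric:
  assumes X: "vector_field A X" and Y: "vector_field A Y" and Z: "vector_field A Z"
  shows "koszul A g X Y Z p + koszul A g X Z Y p = X p (\<lambda>q. g q (Y q) (Z q))"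
proof -
  have sym: "(\<lambda>q. g q (U q) (V q)) = (\<lambda>q. g q (V q) (U q))"
    if "vector_field A U" "vector_field A V" for U V
    using that by (auto simp: fun_eq_iff intro: metric_sym vector_fieldD(1))
  show ?thesis
    unfolding koszul_def sym[OF Z Y] sym[OF Z X] sym[OF Y X]
      metric_lie_antisym[OF Z X vector_fieldD(1)[OF Y]]
      metric_lie_antisym[OF Y X vector_fieldD(1)[OF Z]]
      metric_lie_antisym[OF Y Z vector_fieldD(1)[OF X]]
    by (simp add: field_simps)
qed

end

text \<open>The chosen representative may differ from \<open>nabla X Y p\<close> by a radical
  vector. Both give the same pairing with values of vector fields, and by
  \<open>tangent_vector_extends\<close> these values exhaust the tangent space.\<close>

lemma flat_rep_koszul_derivative:
  fixes A :: "('a::t2_space set \<times> ('a \<Rightarrow> 'n::euclidean_space)) set"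
  assumes A: "smooth_atlas A" and "koszul_derivative A g nabla" "vector_field A X" "vector_field A Y"
  shows "flat_rep A g (nabla_flat A g X Y) p \<in> tangent_space A p"
    and "w \<in> tangent_space A p \<Longrightarrow> g p (flat_rep A g (nabla_flat A g X Y) p) w = g p (nabla X Y p) w"
proof -
  define u where "u = flat_rep A g (nabla_flat A g X Y) p"
  have nabla: "vector_field A (nabla X Y)"
    "\<And>Z. vector_field A Z \<Longrightarrow> g p (nabla X Y p) (Z p) = nabla_flat A g X Y Z p"
    using assms(2-4) by (auto simp: koszul_derivative_def nabla_flat_def)
  have "u \<in> tangent_space A p \<and> (\<forall>Z. vector_field A Z \<longrightarrow> nabla_flat A g X Y Z p = g p u (Z p))"
    unfolding u_def flat_rep_def
    \<comment> \<open>The Koszul derivative itself witnesses that the choice in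
      \<open>flat_rep\<close> is not vacuous.\<close>
    by (rule someI[of _ "nabla X Y p"]) (use nabla vector_fieldD(1) in auto)
  then have u: "u \<in> tangent_space A p" "\<And>Z. vector_field A Z \<Longrightarrow> nabla_flat A g X Y Z p = g p u (Z p)"
    by blast+
  show "flat_rep A g (nabla_flat A g X Y) p \<in> tangent_space A p"
    using u(1) by (simp add: u_def)
  show "g p (flat_rep A g (nabla_flat A g X Y) p) w = g p (nabla X Y p) w" if w: "w \<in> tangent_space A p"
  proof -
    obtain Z where Z: "vector_field A Z" "Z p = w" by (rule tangent_vector_extends[OF A w])
    then show ?thesis using nabla(2)[OF Z(1)] u(2)[OF Z(1)] by (simp add: u_def)
  qed
qed

theorem theorem8p7:
  fixes A :: "('a::{t2_space, second_countable_topology} set \<times> ('a \<Rightarrow> 'n::euclidean_space)) set"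
    and g :: "'a \<Rightarrow> 'a tvec \<Rightarrow> 'a tvec \<Rightarrow> real"
    and nabla :: "('a \<Rightarrow> 'a tvec) \<Rightarrow> ('a \<Rightarrow> 'a tvec) \<Rightarrow> ('a \<Rightarrow> 'a tvec)"
  assumes "singular_semi_riemannian A g"
    and "constant_signature A g"
    and "radical_stationary A g"
    and "koszul_derivative A g nabla"
    and "vector_field A X" and "vector_field A Y" and "vector_field A Z" and "vector_field A T"
  shows "\<forall>p. g p (curv_nabla A nabla X Y Z p) (T p) = riem A g X Y Z T p"
proof
  fix p
  have A: "smooth_atlas A" and g: "sym_bilinear_field A g"
    using assms(1) by (simp_all add: singular_semi_riemannian_def smooth_manifold_def)
  have nabla: "vector_field A (nabla V W)"
    and koszul: "vector_field A S \<Longrightarrow> g q (nabla V W q) (S q) = koszul A g V W S q"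
    if "vector_field A V" "vector_field A W" for V W S q
    using assms(4) that by (auto simp: koszul_derivative_def)
  note tangent = vector_fieldD(1)
  have cov: "cov_form A g V (nabla_flat A g W Z) T p = g p (nabla V (nabla W Z) p) (T p)"
    if V: "vector_field A V" and W: "vector_field A W" for V W
  proof -
    note WZ = nabla[OF W assms(7)] and VT = nabla[OF V assms(8)]
    note repVT = flat_rep_koszul_derivative[OF A assms(4) V assms(8), where p = p]
      and repWZ = flat_rep_koszul_derivative[OF A assms(4) W assms(7), where p = p]
    \<comment> \<open>The two representatives are replaced one after the other; symmetry brings each
      into the first slot, where the representative lemma applies.\<close>
    have "annih_inner A g (nabla_flat A g V T) (nabla_flat A g W Z) p
        = g p (nabla V T p) (flat_rep A g (nabla_flat A g W Z) p)"
      unfolding annih_inner_def by (rule repVT(2)[OF repWZ(1)])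
    also have "\<dots> = g p (flat_rep A g (nabla_flat A g W Z) p) (nabla V T p)"
      by (rule metric_sym[OF A g tangent[OF VT] repWZ(1)])
    also have "\<dots> = g p (nabla W Z p) (nabla V T p)"
      by (rule repWZ(2)[OF tangent[OF VT]])
    also have "\<dots> = g p (nabla V T p) (nabla W Z p)"
      by (rule metric_sym[OF A g tangent[OF WZ] tangent[OF VT]])
    also have "\<dots> = koszul A g V T (nabla W Z) p"
      by (rule koszul[OF V assms(8) WZ])
    finally have inner: "annih_inner A g (nabla_flat A g V T) (nabla_flat A g W Z) p
        = koszul A g V T (nabla W Z) p" .
    \<comment> \<open>Equality at \<open>p\<close> would not suffice: \<open>V\<close>
      differentiates this function, so it is needed at every point.\<close>
    have "nabla_flat A g W Z T = (\<lambda>q. g q (nabla W Z q) (T q))"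
      using koszul[OF W assms(7,8)] by (simp add: nabla_flat_def fun_eq_iff)
    then have "cov_form A g V (nabla_flat A g W Z) T p = koszul A g V (nabla W Z) T p"
      using koszul_metric[OF A g V WZ assms(8), of p] inner by (simp add: cov_form_def)
    also have "\<dots> = g p (nabla V (nabla W Z) p) (T p)"
      by (rule koszul[OF V WZ assms(8), symmetric])
    finally show ?thesis .
  qed
  note XY = vector_field_lie[OF A assms(5,6)]
  note fields = tangent[OF nabla[OF assms(5) nabla[OF assms(6,7)]], of p]
    tangent[OF nabla[OF assms(6) nabla[OF assms(5,7)]], of p]
    tangent[OF nabla[OF XY assms(7)], of p] tangent[OF assms(8), of p]
  have "g p (curv_nabla A nabla X Y Z p) (T p) = g p (nabla X (nabla Y Z) p) (T p)
      - g p (nabla Y (nabla X Z) p) (T p) - g p (nabla (lie A X Y) Z p) (T p)"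
    unfolding curv_nabla_def
    using fields by (simp add: metric_diff[OF A g] tangent_space_diff)
  also have "\<dots> = riem A g X Y Z T p"
    \<comment> \<open>Only the bracket term is unfolded to the Koszul form; the other two stay
      folded to match \<open>cov\<close>.\<close>
    unfolding riem_def nabla_flat_def[of A g "lie A X Y"]
    using cov[OF assms(5,6)] cov[OF assms(6,5)] koszul[OF XY assms(7,8)] by simp
  finally show "g p (curv_nabla A nabla X Y Z p) (T p) = riem A g X Y Z T p" .
qed

end
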